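(* Let $Z_q(n,k)$ denote the center of $\mathrm{Cl}_q(n,k)$. Then \[ Z_q(n,k)\cong \mathbb{k}[\mathbb{Z}_{2k}]\otimes\cdots\otimes\mathbb{k}[\mathbb{Z}_{2k}] = \mathbb{k}[\mathbb{Z}_{2k}^n] \] (group algebra of the product of $n$ cyclic groups of order $2k$). In particular, $Z_q(n,k)$ is generated by the elements of order $2k$ \[ z_a = q\omega_a - (q-1)\psi_a\psi_a^*\omega_a^{k+1},\qquad a=1,\dots,n. \] Moreover, $\dim Z_q(n,k)=(2k)^n$, and each $z_a$ satisfies $\psi_a\psi_a^*+\psi_a^*\psi_a = z_a^k$.
   Context: Let $\mathbb{k}$ be a field of characteristic different from $2$, let $q\in\mathbb{k}^\times$, and let $n,k$ be positive integers. The quantum Clifford algebra $\mathrm{Cl}_q(n,k)$ is the unital associative $\mathbb{k}$-algebra generated by $\psi_a,\psi_a^*,\omega_a,\omega_a^{-1}$ for $a\in\{1,\dots,n\}$, subject to the relations (for all $a,b\in\{1,\dots,n\}$): $\omega_a\omega_b=\omega_b\omega_a$; $\omega_a\omega_a^{-1}=1$; $\omega_a\psi_b=q^{\delta_{ab}}\psi_b\omega_a$; $\omega_a\psi_b^*=q^{-\delta_{ab}}\psi_b^*\omega_a$; $\psi_a\psi_b+\psi_b\psi_a=0$; $\psi_a^*\psi_b^*+\psi_b^*\psi_a^*=0$; $\psi_a\psi_a^*+q^k\psi_a^*\psi_a=\omega_a^{-k}$; $\psi_a\psi_a^*+q^{-k}\psi_a^*\psi_a=\omega_a^{k}$; and $\psi_a\psi_b^*+\psi_b^*\psi_a=0$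 if $a\neq b$. $\mathbb{Z}_{2k}=\mathbb{Z}/2k\mathbb{Z}$. *)

theory Defs
  imports Main "HOL-Library.Poly_Mapping"
begin

text \<open>Words over an alphabet, made into a monoid (concatenation), so that
  finitely supported functions from words to a field form the free
  associative unital algebra (multiplication = convolution).\<close>

datatype 'g word = Word "'g list"

instantiation word :: (type) monoid_add
begin
definition zero_word :: "'g word" where "zero_word = Word []"
fun plus_word :: "'g word \<Rightarrow> 'g word \<Rightarrow> 'g word" where
  "plus_word (Word xs) (Word ys) = Word (xs @ ys)"
instance
proof
  fix a b c :: "'g word"
  show "a + b + c = a + (b + c)" by (cases a; cases b; cases c) simp
  show "0 + a = a" by (cases a) (simp add: zero_word_def)
  show "a + 0 = a" by (cases a) (simp add: zero_word_def)
qed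
end

text \<open>Generators of the quantum Clifford algebra, indexed by a finite type
  \<open>'n\<close> (playing the role of \<open>{1,...,n}\<close>, with \<open>n = CARD('n)\<close>):
  \<open>Psi a = \<psi>_a\<close>, \<open>PsiS a = \<psi>_a^*\<close>, \<open>Om a = \<omega>_a\<close>, \<open>OmI a = \<omega>_a^{-1}\<close>.\<close>

datatype 'n gen = Psi 'n | PsiS 'n | Om 'n | OmI 'n

type_synonym ('n, 'k) freealg = "'n gen word \<Rightarrow>\<^sub>0 'k"

definition gen :: "'n gen \<Rightarrow> ('n, 'k::field) freealg" where
  "gen x = Poly_Mapping.single (Word [x]) 1"

definition const :: "'k::field \<Rightarrow> ('n, 'k) freealg" where
  "const c = Poly_Mapping.single 0 c"

definition psi :: "'n \<Rightarrow> ('n, 'k::field) freealg" where "psi a = gen (Psi a)"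
definition psis :: "'n \<Rightarrow> ('n, 'k::field) freealg" where "psis a = gen (PsiS a)"
definition om :: "'n \<Rightarrow> ('n, 'k::field) freealg" where "om a = gen (Om a)"
definition omi :: "'n \<Rightarrow> ('n, 'k::field) freealg" where "omi a = gen (OmI a)"

definition kdelta :: "'n \<Rightarrow> 'n \<Rightarrow> nat" where
  "kdelta a b = (if a = b then 1 else 0)"

definition cl_rels :: "'k::field \<Rightarrow> nat \<Rightarrow> ('n, 'k) freealg set" where
  "cl_rels q k =
     {om a * om b - om b * om a | a b. True}
   \<union> {om a * omi a - 1 | a. True}
   \<union> {omi a * om a - 1 | a. True}
   \<union> {om a * psi b - const (q ^ kdelta a b) * psi b * om a | a b. True}
   \<union> {om a * psis b - const (inverse q ^ kdelta a b) * psis b * om a | a b. True}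
   \<union> {psi a * psi b + psi b * psi a | a b. True}
   \<union> {psis a * psis b + psis b * psis a | a b. True}
   \<union> {psi a * psis a + const (q ^ k) * psis a * psi a - omi a ^ k | a. True}
   \<union> {psi a * psis a + const (inverse q ^ k) * psis a * psi a - om a ^ k | a. True}
   \<union> {psi a * psis b + psis b * psi a | a b. a \<noteq> b}"

text \<open>Two-sided ideal of the free algebra generated by the relations.
  \<open>Cl_q(n,k)\<close> is the quotient of the free algebra by this ideal; we
  work with representatives in the free algebra, modulo the ideal.\<close>

inductive_set cl_ideal :: "'k::field \<Rightarrow> nat \<Rightarrow> ('n, 'k) freealg set"
  for q :: 'k and k :: nat where
  rel: "r \<in> cl_rels q k \<Longrightarrow> r \<in> cl_ideal q k"
| zero: "0 \<in> cl_ideal q k"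
| add: "x \<in> cl_ideal q k \<Longrightarrow> y \<in> cl_ideal q k \<Longrightarrow> x + y \<in> cl_ideal q k"
| lmult: "x \<in> cl_ideal q k \<Longrightarrow> u * x \<in> cl_ideal q k"
| rmult: "x \<in> cl_ideal q k \<Longrightarrow> x * u \<in> cl_ideal q k"

definition cl_eq :: "'k::field \<Rightarrow> nat \<Rightarrow> ('n, 'k) freealg \<Rightarrow> ('n, 'k) freealg \<Rightarrow> bool" where
  "cl_eq q k x y \<longleftrightarrow> x - y \<in> cl_ideal q k"

definition cl_center :: "'k::field \<Rightarrow> nat \<Rightarrow> ('n, 'k) freealg set" where
  "cl_center q k = {x. \<forall>y. cl_eq q k (x * y) (y * x)}"

definition zel :: "'k::field \<Rightarrow> nat \<Rightarrow> 'n \<Rightarrow> ('n, 'k) freealg" where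
  "zel q k a = const q * om a - const (q - 1) * psi a * psis a * om a ^ (k + 1)"

inductive_set alg_gen :: "('n, 'k::field) freealg set \<Rightarrow> ('n, 'k) freealg set"
  for S where
  const: "const c \<in> alg_gen S"
| gen: "s \<in> S \<Longrightarrow> s \<in> alg_gen S"
| add: "x \<in> alg_gen S \<Longrightarrow> y \<in> alg_gen S \<Longrightarrow> x + y \<in> alg_gen S"
| mult: "x \<in> alg_gen S \<Longrightarrow> y \<in> alg_gen S \<Longrightarrow> x * y \<in> alg_gen S"

text \<open>Elements of \<open>Z_{2k}^n\<close>: functions \<open>'n \<Rightarrow> nat\<close> with values in \<open>{0..<2k}\<close>;
  group law: componentwise addition mod 2k.  The group algebra is the set of
  \<open>'k\<close>-valued functions supported on this (finite) group, with convolution.\<close>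

definition cgrp :: "nat \<Rightarrow> ('n \<Rightarrow> nat) set" where
  "cgrp k = {g. \<forall>i. g i < 2 * k}"

definition cgadd :: "nat \<Rightarrow> ('n \<Rightarrow> nat) \<Rightarrow> ('n \<Rightarrow> nat) \<Rightarrow> ('n \<Rightarrow> nat)" where
  "cgadd k g h = (\<lambda>i. (g i + h i) mod (2 * k))"

definition galg :: "nat \<Rightarrow> (('n \<Rightarrow> nat) \<Rightarrow> 'k::field) set" where
  "galg k = {f. \<forall>g. g \<notin> cgrp k \<longrightarrow> f g = 0}"

definition ga_mult :: "nat \<Rightarrow> (('n \<Rightarrow> nat) \<Rightarrow> 'k::field) \<Rightarrow> (('n \<Rightarrow> nat) \<Rightarrow> 'k) \<Rightarrow> (('n \<Rightarrow> nat) \<Rightarrow> 'k)" where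
  "ga_mult k f h = (\<lambda>x. if x \<in> cgrp k then
      (\<Sum>g\<in>cgrp k. \<Sum>g'\<in>cgrp k. if cgadd k g g' = x then f g * h g' else 0) else 0)"

definition ga_one :: "('n \<Rightarrow> nat) \<Rightarrow> 'k::field" where
  "ga_one = (\<lambda>g. if g = (\<lambda>_. 0) then 1 else 0)"

definition center_iso :: "'k::field \<Rightarrow> nat \<Rightarrow> ((('n \<Rightarrow> nat) \<Rightarrow> 'k) \<Rightarrow> ('n, 'k) freealg) \<Rightarrow> bool" where
  "center_iso q k phi \<longleftrightarrow>
     (\<forall>f\<in>galg k. phi f \<in> cl_center q k)
   \<and> (\<forall>f\<in>galg k. \<forall>h\<in>galg k. cl_eq q k (phi (\<lambda>g. f g + h g)) (phi f + phi h))
   \<and> (\<forall>f\<in>galg k. \<forall>c. cl_eq q k (phi (\<lambda>g. c * f g)) (const c * phi f))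
   \<and> (\<forall>f\<in>galg k. \<forall>h\<in>galg k. cl_eq q k (phi (ga_mult k f h)) (phi f * phi h))
   \<and> cl_eq q k (phi ga_one) 1
   \<and> (\<forall>f\<in>galg k. cl_eq q k (phi f) 0 \<longrightarrow> f = (\<lambda>_. 0))
   \<and> (\<forall>z\<in>cl_center q k. \<exists>f\<in>galg k. cl_eq q k z (phi f))"

definition center_dim :: "'k::field \<Rightarrow> nat \<Rightarrow> nat \<Rightarrow> ('n itself) \<Rightarrow> bool" where
  "center_dim q k d (_ :: 'n itself) \<longleftrightarrow>
     (\<exists>B :: ('n, 'k) freealg set. finite B \<and> card B = d \<and> B \<subseteq> cl_center q k
       \<and> (\<forall>c. cl_eq q k (\<Sum>b\<in>B. const (c b) * b) 0 \<longrightarrow> (\<forall>b\<in>B. c b = 0))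
       \<and> (\<forall>z\<in>cl_center q k. \<exists>c. cl_eq q k z (\<Sum>b\<in>B. const (c b) * b)))"

end

theory Submission
  imports Defs "HOL-Library.FuncSet"
begin

text \<open>
  Write \<open>e\<^sub>a = \<psi>\<^sub>a \<psi>\<^sub>a\<^sup>* \<omega>\<^sub>a\<^sup>k\<close>. The relations make \<open>e\<^sub>a\<close> and \<open>1 - e\<^sub>a\<close> the diagonal matrix units of a
  \<open>2 \<times> 2\<close> matrix algebra with off-diagonal units \<open>\<psi>\<^sub>a\<close> and \<open>\<psi>\<^sub>a\<^sup>* \<omega>\<^sub>a\<^sup>k\<close>, and
  \<open>z\<^sub>a = \<omega>\<^sub>a e\<^sub>a + q \<omega>\<^sub>a (1 - e\<^sub>a)\<close>. Hence an element that commutes with \<open>\<psi>\<^sub>a\<^sup>*\<close> and is annihilated by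
  \<open>e\<^sub>a\<close> vanishes, so that identities between central elements may be tested after multiplication
  by \<open>e\<^sub>a\<close>, where \<open>z\<^sub>a\<close> agrees with \<open>\<omega>\<^sub>a\<close>.

  Let \<open>e\<close> be the product of all \<open>e\<^sub>a\<close> and \<open>Z\<close> the algebra generated by the \<open>z\<^sub>a\<close>. The left ideal
  generated by \<open>e\<close> is the Fock space spanned over \<open>Z\<close> by the products of \<open>\<psi>\<^sub>a\<^sup>*\<close> applied to \<open>e\<close>,
  and \<open>e \<psi>\<^sub>a\<^sup>* = 0\<close>; so for central \<open>x\<close> we get \<open>x e = e x e = z e\<close> with \<open>z\<close> in \<open>Z\<close>, whence \<open>x = z\<close>.
  The monomials in the \<open>z\<^sub>a\<close> are linearly independent because in the Fock representation over the
  group algebra they translate the vacuum.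
\<close>

section \<open>The free algebra\<close>

text \<open>An update at a fresh key is the addition of a monomial; in this form distributivity
  reduces claims about the free algebra to monomials.\<close>

lemma poly_mapping_single_induct [case_names zero add]:
  fixes f :: "'a \<Rightarrow>\<^sub>0 'b::comm_monoid_add"
  assumes "P 0" "\<And>f w b. P f \<Longrightarrow> P (f + Poly_Mapping.single w b)"
  shows "P f"
proof (induct f rule: update_induct)
  case (update f w b)
  have "Poly_Mapping.update w b f = f + Poly_Mapping.single w b"
    using update(1)
    by (intro poly_mapping_eqI)
      (auto simp: lookup_update lookup_add lookup_single in_keys_iff when_def)
  then show ?case using assms(2)[OF update(3)] by simp
qed (rule assms(1))

text \<open>A separate symbol lets the simp rules below pull scalars to the front of a product
  without interfering with associativity.\<close>

definition smul :: "'k::field \<Rightarrow> ('n, 'k) freealg \<Rightarrow> ('n, 'k) freealg" where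
  "smul c x = const c * x"

text \<open>Constants sit on the empty word, which is neutral on both sides, so on monomials only
  commutativity of the field matters.\<close>

lemma const_central: "const c * x = x * (const c :: ('n, 'k::field) freealg)"
proof (induct x rule: poly_mapping_single_induct)
  case zero
  show ?case by simp
next
  case (add f w b)
  have "const c * Poly_Mapping.single w b = Poly_Mapping.single w b * (const c :: ('n, 'k) freealg)"
    by (simp add: const_def mult_single mult.commute)
  then show ?case
    using add by (simp add: algebra_simps)
qed

lemma const_add: "const (c + d) = const c + const d"
  by (simp add: const_def single_add)

lemma const_mult: "const (c * d) = const c * const d"
  by (simp add: const_def mult_single)

lemma const_one: "const 1 = 1"
  by (simp add: const_def)

lemma const_zero: "const 0 = 0"
  by (simp add: const_def)

lemma const_uminus: "const (- c) = - const c"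
  by (simp add: const_def single_uminus)

lemma const_sum: "const (sum f A) = (\<Sum>x\<in>A. const (f x))"
  by (induct A rule: infinite_finite_induct) (simp_all add: const_zero const_add)

lemma smul_mult_left [simp]: "smul c x * y = smul c (x * y)"
  by (simp add: smul_def mult.assoc)

lemma smul_mult_right [simp]: "x * smul c y = smul c (x * y)"
  by (metis smul_def const_central mult.assoc)

lemma smul_smul [simp]: "smul c (smul d x) = smul (c * d) x"
  by (simp add: smul_def const_mult mult.assoc)

lemma smul_one [simp]: "smul 1 x = x"
  by (simp add: smul_def const_one)

lemma smul_zero_left [simp]: "smul 0 x = 0"
  by (simp add: smul_def const_zero)

lemma smul_zero_right [simp]: "smul c 0 = 0"
  by (simp add: smul_def)

lemma smul_add_left: "smul (c + d) x = smul c x + smul d x"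
  by (simp add: smul_def const_add distrib_right)

lemma smul_diff_left: "smul (c - d) x = smul c x - smul d x"
  by (simp only: diff_conv_add_uminus smul_def const_add const_uminus distrib_right
      mult_minus_left)

lemma smul_sum_right: "smul c (sum f A) = (\<Sum>x\<in>A. smul c (f x))"
  by (simp add: smul_def sum_distrib_left)

lemma smul_sum_left: "smul (sum f A) x = (\<Sum>i\<in>A. smul (f i) x)"
  by (simp add: smul_def const_sum sum_distrib_right)

section \<open>Generated subalgebras and induction over the generators\<close>

lemma alg_gen_power: "x \<in> alg_gen S \<Longrightarrow> x ^ j \<in> alg_gen S"
  by (induct j) (use alg_gen.const[of 1] in \<open>auto simp: const_one intro: alg_gen.mult\<close>)

lemma alg_gen_prod_list: "(\<And>x. x \<in> set xs \<Longrightarrow> x \<in> alg_gen S) \<Longrightarrow> prod_list xs \<in> alg_gen S"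
  by (induct xs) (use alg_gen.const[of 1] in \<open>auto simp: const_one intro: alg_gen.mult\<close>)

lemma alg_gen_sum: "(\<And>x. x \<in> A \<Longrightarrow> u x \<in> alg_gen S) \<Longrightarrow> sum u A \<in> alg_gen S"
  by (induct A rule: infinite_finite_induct)
    (use alg_gen.const[of 0] in \<open>auto simp: const_zero intro: alg_gen.add\<close>)

lemma free_algebra_generated: "x \<in> alg_gen (range (gen :: 'n gen \<Rightarrow> ('n, 'k::field) freealg))"
proof (induct x rule: poly_mapping_single_induct)
  case zero
  show ?case using alg_gen.const[of 0] by (simp add: const_zero)
next
  case (add f w b)
  have word: "Poly_Mapping.single (Word xs) (1::'k) \<in> alg_gen (range gen)" for xs :: "'n gen list"
  proof (induct xs)
    case Nil
    show ?case
      using alg_gen.const[of 1] by (simp add: const_def zero_word_def)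
  next
    case (Cons x xs)
    have "Poly_Mapping.single (Word (x # xs)) (1::'k) = gen x * Poly_Mapping.single (Word xs) 1"
      by (simp add: gen_def mult_single)
    then show ?case
      using Cons by (auto intro: alg_gen.intros)
  qed
  obtain xs where xs: "w = Word xs" by (cases w)
  have "Poly_Mapping.single w b = const b * Poly_Mapping.single w 1"
    by (simp add: const_def mult_single)
  then have "Poly_Mapping.single w b \<in> alg_gen (range gen)"
    using word[of xs] xs by (metis alg_gen.const alg_gen.mult)
  then show ?case
    using add by (simp add: alg_gen.add)
qed

text \<open>Commuting with a fixed element or preserving a subspace is checked on generators and
  carried to the whole algebra by this rule.\<close>

lemma free_algebra_induct [case_names const psi psis om omi add mult]:
  fixes x :: "('n, 'k::field) freealg"
  assumes "\<And>c. P (const c)" "\<And>a. P (psi a)" "\<And>a. P (psis a)" "\<And>a. P (om a)" "\<And>a. P (omi a)"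
    "\<And>x y. P x \<Longrightarrow> P y \<Longrightarrow> P (x + y)" "\<And>x y. P x \<Longrightarrow> P y \<Longrightarrow> P (x * y)"
  shows "P x"
  using free_algebra_generated[of x]
proof induct
  case (gen s)
  then obtain g where "s = gen g" by blast
  then show ?case
    using assms(2-5) by (cases g) (auto simp: psi_def psis_def om_def omi_def)
qed (use assms in auto)

section \<open>Calculus modulo the defining relations\<close>

locale quantum_clifford =
  fixes q :: "'k::field" and k :: nat
  assumes two_neq_zero: "(2::'k) \<noteq> 0"
    and q_neq_zero: "q \<noteq> 0"
    and k_pos: "0 < k"
begin

abbreviation cleq :: "('n, 'k) freealg \<Rightarrow> ('n, 'k) freealg \<Rightarrow> bool" (infix "\<approx>" 50) where
  "x \<approx> y \<equiv> cl_eq q k x y"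

lemma cl_eq_refl [simp, intro]: "x \<approx> x"
  by (simp add: cl_eq_def cl_ideal.zero)

lemma cl_eq_sym: "x \<approx> y \<Longrightarrow> y \<approx> x"
  using cl_ideal.lmult[of "x - y" q k "-1"] by (simp add: cl_eq_def)

lemma cl_eq_trans [trans]: "x \<approx> y \<Longrightarrow> y \<approx> z \<Longrightarrow> x \<approx> z"
  using cl_ideal.add[of "x - y" q k "y - z"] by (simp add: cl_eq_def)

lemma cl_eq_add: "x \<approx> x' \<Longrightarrow> y \<approx> y' \<Longrightarrow> x + y \<approx> x' + y'"
  using cl_ideal.add[of "x - x'" q k "y - y'"] by (simp add: cl_eq_def algebra_simps)

lemma cl_eq_lmult: "x \<approx> y \<Longrightarrow> u * x \<approx> u * y"
  using cl_ideal.lmult[of "x - y" q k u] by (simp add: cl_eq_def algebra_simps)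

lemma cl_eq_rmult: "x \<approx> y \<Longrightarrow> x * u \<approx> y * u"
  using cl_ideal.rmult[of "x - y" q k u] by (simp add: cl_eq_def algebra_simps)

lemma cl_eq_mult: "x \<approx> x' \<Longrightarrow> y \<approx> y' \<Longrightarrow> x * y \<approx> x' * y'"
  by (rule cl_eq_trans[OF cl_eq_rmult cl_eq_lmult])

lemma cl_eq_smul: "x \<approx> y \<Longrightarrow> smul c x \<approx> smul c y"
  by (simp add: smul_def cl_eq_lmult)

lemma cl_eq_uminus: "x \<approx> y \<Longrightarrow> - x \<approx> - y"
  using cl_eq_lmult[of x y "-1"] by simp

lemma cl_eq_diff: "x \<approx> x' \<Longrightarrow> y \<approx> y' \<Longrightarrow> x - y \<approx> x' - y'"
  using cl_eq_add[of x x' "- y" "- y'"] by (simp add: cl_eq_uminus)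

lemma cl_eq_diff_zero: "x - y \<approx> 0 \<longleftrightarrow> x \<approx> y"
  by (simp add: cl_eq_def)

lemma cl_eq_sum: "(\<And>i. i \<in> A \<Longrightarrow> f i \<approx> g i) \<Longrightarrow> sum f A \<approx> sum g A"
  by (induct A rule: infinite_finite_induct) (auto intro: cl_eq_add)

lemma cl_eq_power: "x \<approx> y \<Longrightarrow> x ^ j \<approx> y ^ j"
  by (induct j) (auto intro: cl_eq_mult)

lemma cl_eq_mult_assoc_left: "x * y \<approx> z \<Longrightarrow> x * (y * u) \<approx> z * u"
  using cl_eq_rmult[of "x * y" z u] by (simp add: mult.assoc)

section \<open>Commutation modulo the ideal\<close>

definition commutes :: "('n, 'k) freealg \<Rightarrow> ('n, 'k) freealg \<Rightarrow> bool" where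
  "commutes x y \<longleftrightarrow> x * y \<approx> y * x"

lemma commutes_sym: "commutes x y \<Longrightarrow> commutes y x"
  by (simp add: commutes_def cl_eq_sym)

lemma commutes_const [simp]: "commutes x (const c)"
  by (simp add: commutes_def const_central)

lemma commutes_one [simp]: "commutes x 1"
  by (simp add: commutes_def)

lemma commutes_self [simp]: "commutes x x"
  by (simp add: commutes_def)

lemma commutes_add: "commutes x y \<Longrightarrow> commutes x z \<Longrightarrow> commutes x (y + z)"
  by (simp add: commutes_def distrib_left distrib_right cl_eq_add)

lemma commutes_diff: "commutes x y \<Longrightarrow> commutes x z \<Longrightarrow> commutes x (y - z)"
  by (simp add: commutes_def left_diff_distrib right_diff_distrib cl_eq_diff)

lemma commutes_mult:
  assumes "commutes x y" "commutes x z"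
  shows "commutes x (y * z)"
proof -
  have "x * (y * z) \<approx> y * x * z"
    using assms(1) by (auto simp: commutes_def intro: cl_eq_mult_assoc_left)
  also have "\<dots> = y * (x * z)" by (simp add: mult.assoc)
  also have "\<dots> \<approx> y * (z * x)"
    using assms(2) by (simp add: commutes_def cl_eq_lmult)
  finally show ?thesis by (simp add: commutes_def mult.assoc)
qed

lemma commutes_smul: "commutes x y \<Longrightarrow> commutes x (smul c y)"
  by (simp add: commutes_def cl_eq_smul)

lemma commutes_power: "commutes x y \<Longrightarrow> commutes x (y ^ j)"
  by (induct j) (auto intro: commutes_mult)

lemma commutes_prod_list: "(\<And>y. y \<in> set ys \<Longrightarrow> commutes x y) \<Longrightarrow> commutes x (prod_list ys)"
  by (induct ys) (auto intro: commutes_mult)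

text \<open>The factor \<open>y' * y\<close> is inserted on the left, \<open>x\<close> is moved past
  \<open>y\<close>, and \<open>y * y'\<close> cancels on the right. This covers \<open>omi a\<close>
  in \<open>centralI\<close>.\<close>

lemma commutes_inverse:
  assumes "commutes x y" "y * y' \<approx> 1" "y' * y \<approx> 1"
  shows "commutes x y'"
proof -
  have "x * y' \<approx> y' * y * (x * y')"
    using cl_eq_rmult[OF assms(3), of "x * y'"] by (simp add: cl_eq_sym)
  also have "\<dots> = y' * ((y * x) * y')" by (simp add: mult.assoc)
  also have "\<dots> \<approx> y' * ((x * y) * y')"
    using assms(1) by (intro cl_eq_lmult cl_eq_rmult) (simp add: commutes_def cl_eq_sym)
  also have "\<dots> = y' * x * (y * y')" by (simp add: mult.assoc)
  also have "\<dots> \<approx> y' * x * 1" using assms(2) by (rule cl_eq_lmult)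
  finally show ?thesis by (simp add: commutes_def)
qed

text \<open>Passing \<open>y\<close> through two factors changes the sign twice; the commutator is a
  combination of the two anticommutators.\<close>

lemma commutes_mult_of_anticommuting:
  assumes "x * y + y * x \<approx> 0" "x' * y + y * x' \<approx> 0"
  shows "commutes y (x * x')"
proof -
  have "y * (x * x') - x * x' * y = (x * y + y * x) * x' - x * (x' * y + y * x')"
    by (simp add: algebra_simps)
  also have "\<dots> \<approx> 0 * x' - x * 0"
    by (intro cl_eq_diff cl_eq_lmult cl_eq_rmult assms)
  finally show ?thesis by (simp add: commutes_def cl_eq_diff_zero)
qed

section \<open>The defining relations as congruences\<close>

lemma cl_relI: "r \<in> cl_rels q k \<Longrightarrow> r \<approx> 0"
  by (simp add: cl_eq_def cl_ideal.rel)

lemma om_om: "commutes (om a) (om b)"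
  unfolding commutes_def
  by (subst cl_eq_diff_zero[symmetric], rule cl_relI) (auto simp: cl_rels_def)

lemma om_omi: "om a * omi a \<approx> 1"
  by (subst cl_eq_diff_zero[symmetric], rule cl_relI) (auto simp: cl_rels_def)

lemma omi_om: "omi a * om a \<approx> 1"
  by (subst cl_eq_diff_zero[symmetric], rule cl_relI) (auto simp: cl_rels_def)

lemma om_psi: "om a * psi b \<approx> smul (q ^ kdelta a b) (psi b * om a)"
  unfolding smul_def mult.assoc[symmetric]
  by (subst cl_eq_diff_zero[symmetric], rule cl_relI) (auto simp: cl_rels_def)

lemma om_psis: "om a * psis b \<approx> smul (inverse q ^ kdelta a b) (psis b * om a)"
  unfolding smul_def mult.assoc[symmetric]
  by (subst cl_eq_diff_zero[symmetric], rule cl_relI) (auto simp: cl_rels_def)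

lemma psi_psi: "psi a * psi b + psi b * psi a \<approx> 0"
  by (rule cl_relI) (auto simp: cl_rels_def)

lemma psis_psis: "psis a * psis b + psis b * psis a \<approx> 0"
  by (rule cl_relI) (auto simp: cl_rels_def)

lemma psi_psis_omi: "psi a * psis a + smul (q ^ k) (psis a * psi a) \<approx> omi a ^ k"
  unfolding smul_def mult.assoc[symmetric]
  by (subst cl_eq_diff_zero[symmetric], rule cl_relI) (auto simp: cl_rels_def)

lemma psi_psis_om: "psi a * psis a + smul (inverse q ^ k) (psis a * psi a) \<approx> om a ^ k"
  unfolding smul_def mult.assoc[symmetric]
  by (subst cl_eq_diff_zero[symmetric], rule cl_relI) (auto simp: cl_rels_def)

lemma psi_psis: "a \<noteq> b \<Longrightarrow> psi a * psis b + psis b * psi a \<approx> 0"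
  by (rule cl_relI) (auto simp: cl_rels_def)

lemma psis_psi: "a \<noteq> b \<Longrightarrow> psis a * psi b + psi b * psis a \<approx> 0"
  using psi_psis[of b a] by (simp add: add.commute)

lemma om_psi_same: "om a * psi a \<approx> smul q (psi a * om a)"
  using om_psi[of a a] by (simp add: kdelta_def)

lemma om_psis_same: "om a * psis a \<approx> smul (inverse q) (psis a * om a)"
  using om_psis[of a a] by (simp add: kdelta_def)

lemma om_psi_other: "a \<noteq> b \<Longrightarrow> commutes (om a) (psi b)"
  using om_psi[of a b] by (simp add: kdelta_def commutes_def)

lemma om_psis_other: "a \<noteq> b \<Longrightarrow> commutes (om a) (psis b)"
  using om_psis[of a b] by (simp add: kdelta_def commutes_def)

text \<open>For a repeated index the anticommutation relation only says that twice the square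
  vanishes; characteristic different from 2 allows division.\<close>

lemma square_zero:
  assumes "x * x + x * x \<approx> 0"
  shows "x * x \<approx> 0"
proof -
  have "x * x = smul (inverse 2) (smul 2 (x * x))"
    using two_neq_zero by simp
  also have "smul 2 (x * x) = x * x + x * x"
    using smul_add_left[of 1 1 "x * x"] by simp
  also have "smul (inverse 2) \<dots> \<approx> smul (inverse 2) 0"
    by (intro cl_eq_smul assms)
  finally show ?thesis by simp
qed

lemma psi_square: "psi a * psi a \<approx> 0"
  by (rule square_zero[OF psi_psi])

lemma psis_square: "psis a * psis a \<approx> 0"
  by (rule square_zero[OF psis_psis])

lemma power_q_commute:
  assumes "w * x \<approx> smul c (x * w)"
  shows "w ^ j * x \<approx> smul (c ^ j) (x * w ^ j)"
proof (induct j)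
  case (Suc j)
  have "w ^ Suc j * x = w * (w ^ j * x)" by (simp add: mult.assoc)
  also have "\<dots> \<approx> w * smul (c ^ j) (x * w ^ j)" by (rule cl_eq_lmult) fact
  also have "\<dots> = smul (c ^ j) ((w * x) * w ^ j)" by (simp add: mult.assoc)
  also have "\<dots> \<approx> smul (c ^ j) (smul c (x * w) * w ^ j)"
    by (intro cl_eq_smul cl_eq_rmult assms)
  finally show ?case by (simp add: mult.assoc mult.commute)
qed simp

lemmas om_power_psi = power_q_commute[OF om_psi_same]
lemma om_power_omi_power: "om a ^ j * omi a ^ j \<approx> 1" "omi a ^ j * om a ^ j \<approx> 1"
proof -
  have gen: "x ^ j * y ^ j \<approx> 1" if xy: "x * y \<approx> 1" for x y :: "('c, 'k) freealg"
  proof (induct j)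
    case (Suc j)
    have "x ^ Suc j * y ^ Suc j = x ^ j * (x * y) * y ^ j"
      by (simp only: power_Suc2[of x] power_Suc[of y] mult.assoc)
    also have "\<dots> \<approx> x ^ j * 1 * y ^ j"
      by (intro cl_eq_lmult cl_eq_rmult xy)
    also have "\<dots> \<approx> 1" using Suc by simp
    finally show ?case .
  qed simp
  show "om a ^ j * omi a ^ j \<approx> 1" "omi a ^ j * om a ^ j \<approx> 1"
    by (simp_all add: gen om_omi omi_om)
qed

text \<open>Multiplying the relation for \<open>om a ^ k\<close> by \<open>psi a\<close> on the
  right kills the term ending in \<open>psi a * psi a\<close>. The relation for
  \<open>omi a ^ k\<close> gives a second value of the same product, and comparing the two forces
  periodicity. For \<open>psis a\<close> the same is done from the left.\<close>

lemma psi_psis_psi: "psi a * (psis a * psi a) \<approx> om a ^ k * psi a"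
proof -
  have "om a ^ k * psi a \<approx> (psi a * psis a + smul (inverse q ^ k) (psis a * psi a)) * psi a"
    by (intro cl_eq_rmult cl_eq_sym[OF psi_psis_om])
  also have "\<dots> = psi a * (psis a * psi a) + smul (inverse q ^ k) (psis a * (psi a * psi a))"
    by (simp add: distrib_right mult.assoc)
  also have "\<dots> \<approx> psi a * (psis a * psi a) + smul (inverse q ^ k) (psis a * 0)"
    by (intro cl_eq_add cl_eq_refl cl_eq_smul cl_eq_lmult psi_square)
  finally show ?thesis by (simp add: cl_eq_sym)
qed

lemma psi_psis_psi': "psi a * (psis a * psi a) \<approx> omi a ^ k * psi a"
proof -
  have "omi a ^ k * psi a \<approx> (psi a * psis a + smul (q ^ k) (psis a * psi a)) * psi a"
    by (intro cl_eq_rmult cl_eq_sym[OF psi_psis_omi])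
  also have "\<dots> = psi a * (psis a * psi a) + smul (q ^ k) (psis a * (psi a * psi a))"
    by (simp add: distrib_right mult.assoc)
  also have "\<dots> \<approx> psi a * (psis a * psi a) + smul (q ^ k) (psis a * 0)"
    by (intro cl_eq_add cl_eq_refl cl_eq_smul cl_eq_lmult psi_square)
  finally show ?thesis by (simp add: cl_eq_sym)
qed

lemma psis_psi_psis: "psis a * (psi a * psis a) \<approx> psis a * om a ^ k"
proof -
  have "psis a * om a ^ k \<approx> psis a * (psi a * psis a + smul (inverse q ^ k) (psis a * psi a))"
    by (intro cl_eq_lmult cl_eq_sym[OF psi_psis_om])
  also have "\<dots> = psis a * (psi a * psis a) + smul (inverse q ^ k) ((psis a * psis a) * psi a)"
    by (simp add: distrib_left mult.assoc)
  also have "\<dots> \<approx> psis a * (psi a * psis a) + smul (inverse q ^ k) (0 * psi a)"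
    by (intro cl_eq_add cl_eq_refl cl_eq_smul cl_eq_rmult psis_square)
  finally show ?thesis by (simp add: cl_eq_sym)
qed

lemma psis_psi_psis': "psis a * (psi a * psis a) \<approx> psis a * omi a ^ k"
proof -
  have "psis a * omi a ^ k \<approx> psis a * (psi a * psis a + smul (q ^ k) (psis a * psi a))"
    by (intro cl_eq_lmult cl_eq_sym[OF psi_psis_omi])
  also have "\<dots> = psis a * (psi a * psis a) + smul (q ^ k) ((psis a * psis a) * psi a)"
    by (simp add: distrib_left mult.assoc)
  also have "\<dots> \<approx> psis a * (psi a * psis a) + smul (q ^ k) (0 * psi a)"
    by (intro cl_eq_add cl_eq_refl cl_eq_smul cl_eq_rmult psis_square)
  finally show ?thesis by (simp add: cl_eq_sym)
qed

text \<open>By the two values of \<open>psi a * (psis a * psi a)\<close>, \<open>om a ^ k\<close>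
  and \<open>omi a ^ k\<close> agree in front of \<open>psi a\<close>. The identity is one-sided:
  moving \<open>om a ^ (2 * k)\<close> to the right of \<open>psi a\<close> costs the factor
  \<open>q ^ (2 * k)\<close>.\<close>

lemma om_period_psi: "om a ^ k * (om a ^ k * psi a) \<approx> psi a"
proof -
  have "om a ^ k * (om a ^ k * psi a) \<approx> om a ^ k * (omi a ^ k * psi a)"
    by (intro cl_eq_lmult cl_eq_trans[OF cl_eq_sym[OF psi_psis_psi] psi_psis_psi'])
  also have "\<dots> \<approx> 1 * psi a"
    by (intro cl_eq_mult_assoc_left om_power_omi_power)
  finally show ?thesis by simp
qed

lemma om_period_psis: "psis a * om a ^ k * om a ^ k \<approx> psis a"
proof -
  have "psis a * om a ^ k * om a ^ k \<approx> psis a * omi a ^ k * om a ^ k"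
    by (intro cl_eq_rmult cl_eq_trans[OF cl_eq_sym[OF psis_psi_psis] psis_psi_psis'])
  also have "\<dots> \<approx> psis a * 1"
    unfolding mult.assoc by (intro cl_eq_lmult om_power_omi_power)
  finally show ?thesis by simp
qed

section \<open>Matrix units and the central elements\<close>

text \<open>For equal indices the factors \<open>q\<close> and \<open>inverse q\<close> picked up on
  the way cancel.\<close>

lemma om_psi_psis: "commutes (om b) (psi a * psis a)"
proof (cases "a = b")
  case False
  then show ?thesis by (intro commutes_mult om_psi_other om_psis_other) auto
next
  case True
  have "om a * (psi a * psis a) \<approx> smul q (psi a * om a) * psis a"
    by (intro cl_eq_mult_assoc_left om_psi_same)
  also have "\<dots> = smul q (psi a * (om a * psis a))" by (simp add: mult.assoc)
  also have "\<dots> \<approx> smul q (psi a * smul (inverse q) (psis a * om a))"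
    by (intro cl_eq_smul cl_eq_lmult om_psis_same)
  also have "\<dots> = psi a * psis a * om a"
    using q_neq_zero by (simp add: mult.assoc)
  finally show ?thesis using True by (simp add: commutes_def)
qed

definition eid :: "'n \<Rightarrow> ('n, 'k) freealg" where
  "eid a = psi a * psis a * om a ^ k"

lemma om_eid: "commutes (om b) (eid a)"
  unfolding eid_def by (intro commutes_mult[OF om_psi_psis] commutes_power om_om)

lemma eid_eq: "eid a \<approx> om a ^ k * (psi a * psis a)"
  using commutes_sym[OF commutes_power[OF commutes_sym[OF om_psi_psis]], of a k a]
  by (simp add: eid_def commutes_def cl_eq_sym)

text \<open>\<open>psi b\<close> anticommutes with both \<open>psi a\<close> and
  \<open>psis a\<close>, hence commutes with their product.\<close>

lemma psi_eid_other: "b \<noteq> a \<Longrightarrow> commutes (psi b) (eid a)"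
  unfolding eid_def
  by (intro commutes_mult[OF commutes_mult_of_anticommuting] commutes_power
      commutes_sym[OF om_psi_other] psi_psi psis_psi) auto

lemma psis_eid_other: "b \<noteq> a \<Longrightarrow> commutes (psis b) (eid a)"
  unfolding eid_def
  by (intro commutes_mult[OF commutes_mult_of_anticommuting] commutes_power
      commutes_sym[OF om_psis_other] psi_psis psis_psis) auto

text \<open>Rewriting \<open>psi a * (psis a * psi a)\<close> leaves \<open>om a ^ k\<close> twice
  in front of \<open>psi a\<close>, which periodicity absorbs.\<close>

lemma eid_psi: "eid a * psi a \<approx> psi a"
proof -
  have "eid a * psi a \<approx> om a ^ k * (psi a * psis a) * psi a"
    by (intro cl_eq_rmult eid_eq)
  also have "\<dots> = om a ^ k * (psi a * (psis a * psi a))" by (simp add: mult.assoc)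
  also have "\<dots> \<approx> om a ^ k * (om a ^ k * psi a)" by (intro cl_eq_lmult psi_psis_psi)
  also have "\<dots> \<approx> psi a" by (rule om_period_psi)
  finally show ?thesis .
qed

lemma psi_eid: "psi a * eid a \<approx> 0"
proof -
  have "psi a * eid a = psi a * psi a * (psis a * om a ^ k)"
    by (simp add: eid_def mult.assoc)
  also have "\<dots> \<approx> 0 * (psis a * om a ^ k)" by (intro cl_eq_rmult psi_square)
  finally show ?thesis by simp
qed

lemma eid_psis: "eid a * psis a \<approx> 0"
proof -
  have "eid a * psis a \<approx> om a ^ k * (psi a * psis a) * psis a"
    by (intro cl_eq_rmult eid_eq)
  also have "\<dots> = om a ^ k * psi a * (psis a * psis a)" by (simp add: mult.assoc)
  also have "\<dots> \<approx> om a ^ k * psi a * 0" by (intro cl_eq_lmult psis_square)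
  finally show ?thesis by simp
qed

lemma psis_eid: "psis a * eid a \<approx> psis a"
proof -
  have "psis a * eid a = psis a * (psi a * psis a) * om a ^ k"
    by (simp add: eid_def mult.assoc)
  also have "\<dots> \<approx> psis a * om a ^ k * om a ^ k" by (intro cl_eq_rmult psis_psi_psis)
  also have "\<dots> \<approx> psis a" by (rule om_period_psis)
  finally show ?thesis .
qed

lemma eid_idem: "eid a * eid a \<approx> eid a"
  using cl_eq_rmult[OF eid_psi, of a "psis a * om a ^ k"] by (simp add: eid_def mult.assoc)

lemma eid_eid: "commutes (eid b) (eid a)"
proof (cases "a = b")
  case False
  have "commutes (eid a) (eid b)"
    unfolding eid_def[of b]
    by (intro commutes_mult commutes_power commutes_sym[OF om_eid] commutes_sym[OF psi_eid_other]
        commutes_sym[OF psis_eid_other] False[symmetric])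
  then show ?thesis by (rule commutes_sym)
qed simp

text \<open>In \<open>omi a ^ k * om a ^ k\<close> the first factor is expanded by its relation; the
  coefficient \<open>q ^ k\<close> is exactly what moving \<open>om a ^ k\<close> to the left of
  \<open>psi a\<close> absorbs.\<close>

lemma one_minus_eid: "1 - eid a \<approx> psis a * om a ^ k * psi a"
proof -
  have "1 \<approx> omi a ^ k * om a ^ k"
    by (rule cl_eq_sym[OF om_power_omi_power(2)])
  also have "\<dots> \<approx> (psi a * psis a + smul (q ^ k) (psis a * psi a)) * om a ^ k"
    by (intro cl_eq_rmult cl_eq_sym[OF psi_psis_omi])
  also have "\<dots> = eid a + psis a * smul (q ^ k) (psi a * om a ^ k)"
    by (simp add: eid_def distrib_right mult.assoc)
  also have "\<dots> \<approx> eid a + psis a * (om a ^ k * psi a)"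
    by (intro cl_eq_add cl_eq_refl cl_eq_lmult cl_eq_sym[OF om_power_psi])
  finally have "1 - eid a \<approx> eid a + psis a * (om a ^ k * psi a) - eid a"
    by (intro cl_eq_diff cl_eq_refl)
  then show ?thesis by (simp add: mult.assoc)
qed

text \<open>In \<open>y * (1 - eid a)\<close>, written with \<open>one_minus_eid\<close>,
  \<open>y\<close> moves past \<open>psis a\<close>; an \<open>eid a\<close> inserted before the
  final \<open>psi a\<close> moves left through \<open>om a ^ k\<close> until it meets
  \<open>y\<close> and gives zero.\<close>

lemma annihilator_eid:
  assumes comm: "commutes y (psis a)" and zero: "y * eid a \<approx> 0"
  shows "y \<approx> 0"
proof -
  have "y - y * eid a = y * (1 - eid a)" by (simp add: algebra_simps)
  also have "\<dots> \<approx> y * (psis a * om a ^ k * psi a)"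
    by (intro cl_eq_lmult one_minus_eid)
  also have "\<dots> = (y * psis a) * (om a ^ k * psi a)" by (simp add: mult.assoc)
  also have "\<dots> \<approx> (psis a * y) * (om a ^ k * (eid a * psi a))"
    using comm
    by (intro cl_eq_mult[OF _ cl_eq_lmult[OF cl_eq_sym[OF eid_psi]]]) (simp add: commutes_def)
  also have "\<dots> = psis a * y * (om a ^ k * eid a) * psi a" by (simp add: mult.assoc)
  also have "\<dots> \<approx> psis a * y * (eid a * om a ^ k) * psi a"
    using commutes_power[OF commutes_sym[OF om_eid], of a a k]
    by (intro cl_eq_lmult cl_eq_rmult) (simp add: commutes_def cl_eq_sym)
  also have "\<dots> = psis a * (y * eid a) * (om a ^ k * psi a)" by (simp add: mult.assoc)
  also have "\<dots> \<approx> psis a * 0 * (om a ^ k * psi a)"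
    by (intro cl_eq_lmult cl_eq_rmult zero)
  finally have "y - y * eid a \<approx> 0" by simp
  then have "y \<approx> y * eid a" by (simp add: cl_eq_diff_zero)
  then show ?thesis using zero by (rule cl_eq_trans)
qed

section \<open>Centrality, period and \<open>k\<close>-th power of \<open>zel q k a\<close>\<close>

lemma zel_eq: "zel q k a = smul q (om a) - smul (q - 1) (eid a * om a)"
  by (simp add: zel_def eid_def smul_def mult.assoc power_commutes)

lemma eid_om_swap: "eid a * om a * x \<approx> om a * (eid a * x)"
  using cl_eq_rmult[OF om_eid[unfolded commutes_def], of a a x]
  by (simp add: mult.assoc cl_eq_sym)

lemma zel_eid: "zel q k a * eid a \<approx> om a * eid a"
proof -
  have "zel q k a * eid a = smul q (om a * eid a) - smul (q - 1) (eid a * om a * eid a)"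
    by (simp add: zel_eq left_diff_distrib)
  also have "\<dots> \<approx> smul q (om a * eid a) - smul (q - 1) (om a * eid a)"
    by (intro cl_eq_diff cl_eq_smul cl_eq_refl cl_eq_trans[OF eid_om_swap] cl_eq_lmult eid_idem)
  also have "\<dots> = om a * eid a"
    by (simp add: smul_diff_left)
  finally show ?thesis .
qed

text \<open>To the left of \<open>psi a\<close>, \<open>eid a\<close> acts as 1 and leaves
  \<open>om a * psi a\<close>; to the right it acts as 0 and leaves \<open>q\<close> times
  \<open>psi a * om a\<close>. These agree by the relation between \<open>om a\<close> and
  \<open>psi a\<close>.\<close>

lemma zel_psi_same: "commutes (zel q k a) (psi a)"
proof -
  have "zel q k a * psi a = smul q (om a * psi a) - smul (q - 1) (eid a * om a * psi a)"
    by (simp add: zel_eq left_diff_distrib)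
  also have "\<dots> \<approx> smul q (om a * psi a) - smul (q - 1) (om a * psi a)"
    by (intro cl_eq_diff cl_eq_smul cl_eq_refl cl_eq_trans[OF eid_om_swap] cl_eq_lmult eid_psi)
  also have "\<dots> = om a * psi a"
    by (simp add: smul_diff_left)
  also have "\<dots> \<approx> smul q (psi a * om a)" by (rule om_psi_same)
  also have "\<dots> = smul q (psi a * om a) - smul (q - 1) (0 * om a)" by simp
  also have "\<dots> \<approx> smul q (psi a * om a) - smul (q - 1) (psi a * eid a * om a)"
    by (intro cl_eq_diff cl_eq_smul cl_eq_refl cl_eq_rmult cl_eq_sym[OF psi_eid])
  also have "\<dots> = psi a * zel q k a"
    by (simp add: zel_eq right_diff_distrib mult.assoc)
  finally show ?thesis by (simp add: commutes_def)
qed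

text \<open>The roles are exchanged: \<open>eid a\<close> acts as 0 from the left and as 1 from the
  right, and both sides become \<open>psis a * om a\<close>.\<close>

lemma zel_psis_same: "commutes (zel q k a) (psis a)"
proof -
  have "zel q k a * psis a = smul q (om a * psis a) - smul (q - 1) (eid a * om a * psis a)"
    by (simp add: zel_eq left_diff_distrib)
  also have "\<dots> \<approx> smul q (smul (inverse q) (psis a * om a)) - smul (q - 1) (om a * 0)"
    by (intro cl_eq_diff cl_eq_smul om_psis_same cl_eq_trans[OF eid_om_swap] cl_eq_lmult eid_psis)
  also have "\<dots> = smul q (psis a * om a) - smul (q - 1) (psis a * om a)"
    using q_neq_zero by (simp add: smul_diff_left)
  also have "\<dots> \<approx> smul q (psis a * om a) - smul (q - 1) (psis a * eid a * om a)"
    by (intro cl_eq_diff cl_eq_smul cl_eq_refl cl_eq_rmult cl_eq_sym[OF psis_eid])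
  also have "\<dots> = psis a * zel q k a"
    by (simp add: zel_eq right_diff_distrib mult.assoc)
  finally show ?thesis by (simp add: commutes_def)
qed

lemma commutes_zelI: "commutes y (om a) \<Longrightarrow> commutes y (eid a) \<Longrightarrow> commutes y (zel q k a)"
  unfolding zel_eq by (intro commutes_diff commutes_smul commutes_mult)

text \<open>The elements commuting with \<open>x\<close> form a subalgebra, and commutation with
  \<open>om a\<close> passes to its inverse.\<close>

lemma centralI:
  assumes psi: "\<And>a. commutes x (psi a)" and psis: "\<And>a. commutes x (psis a)"
    and om: "\<And>a. commutes x (om a)"
  shows "x \<in> cl_center q k"
proof -
  have "commutes x y" for y
  proof (induct y rule: free_algebra_induct)
    case (omi a)
    show ?case using om om_omi omi_om by (rule commutes_inverse)
  qed (simp_all add: assms commutes_add commutes_mult)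
  then show ?thesis by (simp add: cl_center_def commutes_def)
qed

lemma centralD: "x \<in> cl_center q k \<Longrightarrow> commutes x y"
  by (simp add: cl_center_def commutes_def)

lemma zel_central: "zel q k a \<in> cl_center q k"
proof (rule centralI)
  fix b
  show "commutes (zel q k a) (psi b)"
  proof (cases "a = b")
    case False
    then show ?thesis
      by (intro commutes_sym[OF commutes_zelI] psi_eid_other commutes_sym[OF om_psi_other]) auto
  qed (simp add: zel_psi_same)
  show "commutes (zel q k a) (psis b)"
  proof (cases "a = b")
    case False
    then show ?thesis
      by (intro commutes_sym[OF commutes_zelI] psis_eid_other commutes_sym[OF om_psis_other]) auto
  qed (simp add: zel_psis_same)
  show "commutes (zel q k a) (om b)"
    by (intro commutes_sym[OF commutes_zelI] om_om om_eid)
qed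

lemma zel_power_eid: "zel q k a ^ j * eid a \<approx> om a ^ j * eid a"
proof (induct j)
  case (Suc j)
  have "zel q k a ^ Suc j * eid a = zel q k a * (zel q k a ^ j * eid a)"
    by (simp add: mult.assoc)
  also have "\<dots> \<approx> zel q k a * (om a ^ j * eid a)" by (rule cl_eq_lmult) fact
  also have "\<dots> \<approx> om a ^ j * zel q k a * eid a"
    using centralD[OF zel_central] by (intro cl_eq_mult_assoc_left) (simp add: commutes_def)
  also have "\<dots> = om a ^ j * (zel q k a * eid a)" by (simp add: mult.assoc)
  also have "\<dots> \<approx> om a ^ j * (om a * eid a)" by (intro cl_eq_lmult zel_eid)
  also have "\<dots> = om a ^ Suc j * eid a"
    by (simp only: power_Suc2 mult.assoc)
  finally show ?case .
qed simp

lemma om_period_eid: "om a ^ (2 * k) * eid a \<approx> eid a"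
  using cl_eq_rmult[OF om_period_psi, of a "psis a * om a ^ k"]
  by (simp add: eid_def mult.assoc power_add mult_2)

text \<open>On \<open>eid a\<close> the element acts as \<open>om a\<close>, whose power
  \<open>2 * k\<close> fixes \<open>eid a\<close>; \<open>annihilator_eid\<close> then removes the
  factor \<open>eid a\<close>.\<close>

lemma zel_period: "zel q k a ^ (2 * k) \<approx> 1"
proof -
  have "zel q k a ^ (2 * k) - 1 \<approx> 0"
  proof (rule annihilator_eid)
    show "commutes (zel q k a ^ (2 * k) - 1) (psis a)"
      by (intro commutes_sym[OF commutes_diff] commutes_power commutes_one
          commutes_sym[OF centralD[OF zel_central]])
    have "(zel q k a ^ (2 * k) - 1) * eid a = zel q k a ^ (2 * k) * eid a - eid a"
      by (simp add: left_diff_distrib)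
    also have "\<dots> \<approx> eid a - eid a"
      by (intro cl_eq_diff cl_eq_refl cl_eq_trans[OF zel_power_eid om_period_eid])
    finally show "(zel q k a ^ (2 * k) - 1) * eid a \<approx> 0" by simp
  qed
  then show ?thesis by (simp add: cl_eq_diff_zero)
qed

text \<open>Both sides commute with \<open>psis a\<close>, so they may be compared after
  multiplication by \<open>eid a\<close>. The left side then reduces to
  \<open>psi a * psis a\<close>, and so does \<open>om a ^ k * eid a\<close> by periodicity.\<close>

lemma anticommutator_eq_zel_power: "psi a * psis a + psis a * psi a \<approx> zel q k a ^ k"
proof -
  have "psis a * (psi a * psis a + psis a * psi a) \<approx> (psi a * psis a + psis a * psi a) * psis a"
  proof -
    \<comment> \<open>The two copies of \<open>psis a * psi a * psis a\<close> cancel, leaving terms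
      that contain the square of \<open>psis a\<close>.\<close>
    have "psis a * (psi a * psis a + psis a * psi a)
        - (psi a * psis a + psis a * psi a) * psis a
      = psis a * psis a * psi a - psi a * (psis a * psis a)"
      by (simp add: algebra_simps)
    also have "\<dots> \<approx> 0 * psi a - psi a * 0"
      by (intro cl_eq_diff cl_eq_lmult cl_eq_rmult psis_square)
    finally show ?thesis by (simp add: cl_eq_diff_zero)
  qed
  then have comm: "commutes (psis a) (psi a * psis a + psis a * psi a)"
    by (simp add: commutes_def)
  have "psi a * psis a + psis a * psi a - zel q k a ^ k \<approx> 0"
  proof (rule annihilator_eid)
    show "commutes (psi a * psis a + psis a * psi a - zel q k a ^ k) (psis a)"
      by (intro commutes_sym[OF commutes_diff] comm commutes_power
          commutes_sym[OF centralD[OF zel_central]])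
    have "(psi a * psis a + psis a * psi a - zel q k a ^ k) * eid a
        = psi a * (psis a * eid a) + psis a * (psi a * eid a) - zel q k a ^ k * eid a"
      by (simp add: algebra_simps)
    also have "\<dots> \<approx> psi a * psis a + psis a * 0 - om a ^ k * eid a"
      by (intro cl_eq_diff cl_eq_add cl_eq_lmult psis_eid psi_eid zel_power_eid)
    also have "\<dots> = psi a * psis a - om a ^ k * eid a" by simp
    also have "\<dots> \<approx> psi a * psis a - om a ^ k * (om a ^ k * (psi a * psis a))"
      by (intro cl_eq_diff cl_eq_refl cl_eq_lmult eid_eq)
    also have "\<dots> \<approx> psi a * psis a - psi a * psis a"
      using cl_eq_rmult[OF om_period_psi, of a "psis a"]
      by (intro cl_eq_diff cl_eq_refl) (simp add: mult.assoc)
    finally show "(psi a * psis a + psis a * psi a - zel q k a ^ k) * eid a \<approx> 0" by simp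
  qed
  then show ?thesis by (simp add: cl_eq_diff_zero)
qed

end

section \<open>The vacuum idempotent and generation of the center\<close>

text \<open>Factors in the free algebra do not commute strictly, so products over all indices follow
  one fixed enumeration.\<close>

definition modes :: "'n::finite list" where
  "modes = (SOME xs. set xs = UNIV \<and> distinct xs)"

lemma modes: "set (modes :: 'n::finite list) = UNIV" "distinct (modes :: 'n list)"
  using someI_ex[OF finite_distinct_list[OF finite_UNIV]] by (auto simp: modes_def)

context quantum_clifford
begin

definition vac :: "('n::finite, 'k) freealg" where
  "vac = prod_list (map eid modes)"

lemma commutes_vac: "(\<And>a. commutes y (eid a)) \<Longrightarrow> commutes y vac"
  unfolding vac_def by (rule commutes_prod_list) auto

lemma eid_vac: "eid a * vac \<approx> vac"
proof -
  have "eid a * prod_list (map eid xs) \<approx> prod_list (map eid xs)" if "a \<in> set xs" for xs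
    using that
  proof (induct xs)
    case (Cons x xs)
    show ?case
    proof (cases "x = a")
      case True
      have "eid a * (eid a * prod_list (map eid xs)) \<approx> eid a * prod_list (map eid xs)"
        by (rule cl_eq_mult_assoc_left[OF eid_idem])
      then show ?thesis using True by simp
    next
      case False
      have "eid a * (eid x * prod_list (map eid xs)) \<approx> eid x * eid a * prod_list (map eid xs)"
        by (rule cl_eq_mult_assoc_left[OF eid_eid[unfolded commutes_def]])
      also have "\<dots> = eid x * (eid a * prod_list (map eid xs))" by (simp add: mult.assoc)
      also have "\<dots> \<approx> eid x * prod_list (map eid xs)"
        using False Cons by (intro cl_eq_lmult) auto
      finally show ?thesis by simp
    qed
  qed simp
  then show ?thesis by (simp add: vac_def modes)
qed

lemma vac_eid: "vac * eid a \<approx> vac"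
  using cl_eq_trans[OF cl_eq_sym eid_vac] commutes_vac[of "eid a", OF eid_eid]
  by (simp add: commutes_def)

lemma vac_idem: "vac * vac \<approx> (vac :: ('n::finite, 'k) freealg)"
proof -
  have "prod_list (map eid xs) * vac \<approx> vac" for xs :: "'n list"
  proof (induct xs)
    case (Cons x xs)
    then have "eid x * (prod_list (map eid xs) * vac) \<approx> eid x * vac"
      by (rule cl_eq_lmult)
    also have "\<dots> \<approx> vac" by (rule eid_vac)
    finally show ?case by (simp add: mult.assoc)
  qed simp
  then show ?thesis by (simp add: vac_def)
qed

lemma zel_vac: "zel q k a * vac \<approx> om a * vac"
proof -
  have "zel q k a * vac \<approx> zel q k a * (eid a * vac)"
    by (intro cl_eq_lmult cl_eq_sym[OF eid_vac])
  also have "\<dots> \<approx> om a * eid a * vac"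
    by (rule cl_eq_mult_assoc_left[OF zel_eid])
  also have "\<dots> \<approx> om a * vac"
    unfolding mult.assoc by (intro cl_eq_lmult eid_vac)
  finally show ?thesis .
qed

lemma psi_vac: "psi a * vac \<approx> 0"
proof -
  have "psi a * vac \<approx> psi a * (eid a * vac)"
    by (intro cl_eq_lmult cl_eq_sym[OF eid_vac])
  also have "\<dots> \<approx> 0 * vac"
    by (rule cl_eq_mult_assoc_left[OF psi_eid])
  finally show ?thesis by simp
qed

lemma vac_psis: "vac * psis a \<approx> 0"
proof -
  have "vac * psis a \<approx> vac * eid a * psis a"
    by (intro cl_eq_rmult cl_eq_sym[OF vac_eid])
  also have "\<dots> \<approx> vac * 0"
    unfolding mult.assoc by (intro cl_eq_lmult eid_psis)
  finally show ?thesis by simp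
qed

lemma annihilator_vac:
  fixes y :: "('n::finite, 'k) freealg"
  assumes y: "y \<in> cl_center q k" and zero: "y * vac \<approx> 0"
  shows "y \<approx> 0"
proof -
  \<comment> \<open>The factors \<open>eid x\<close> are peeled off one at a time. Centrality is
    weakened for the induction: \<open>y * eid x\<close> need no longer commute with
    \<open>psis x\<close>, but it does with \<open>psis a\<close> for the remaining
    \<open>a\<close>, which differ from \<open>x\<close>.\<close>
  have "y \<approx> 0" if "distinct xs" "\<And>a. a \<in> set xs \<Longrightarrow> commutes y (psis a)"
    "y * prod_list (map eid xs) \<approx> 0" for y :: "('n, 'k) freealg" and xs
    using that
  proof (induct xs arbitrary: y)
    case (Cons x xs)
    have "y * eid x \<approx> 0"
    proof (rule Cons.hyps)
      show "distinct xs" using Cons.prems by simp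
      show "y * eid x * prod_list (map eid xs) \<approx> 0"
        using Cons.prems by (simp add: mult.assoc)
      fix a assume "a \<in> set xs"
      then show "commutes (y * eid x) (psis a)"
        using Cons.prems(1,2)
        by (intro commutes_sym[OF commutes_mult] psis_eid_other commutes_sym[of y]) auto
    qed
    then show ?case
      using Cons.prems(2) by (intro annihilator_eid[of y x]) auto
  qed simp
  from this[OF modes(2) centralD[OF y]] zero show ?thesis by (simp add: vac_def)
qed

lemma alg_gen_zel_central:
  assumes "z \<in> alg_gen (range (zel q k))"
  shows "commutes y z"
  using assms
proof induct
  case (gen s)
  then obtain a where "s = zel q k a" by blast
  then show ?case using commutes_sym[OF centralD[OF zel_central]] by simp
qed (simp_all add: commutes_add commutes_mult)

section \<open>The Fock space built on the vacuum\<close>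

inductive_set fock :: "('n::finite, 'k) freealg set" where
  vac: "z \<in> alg_gen (range (zel q k)) \<Longrightarrow> z * vac \<in> fock"
| add: "x \<in> fock \<Longrightarrow> y \<in> fock \<Longrightarrow> x + y \<in> fock"
| psis: "x \<in> fock \<Longrightarrow> psis a * x \<in> fock"

text \<open>\<open>fock\<close> consists of particular representatives; this is its closure modulo
  the relations, which turns out to be stable under all generators.\<close>

definition in_fock :: "('n::finite, 'k) freealg \<Rightarrow> bool" where
  "in_fock x \<longleftrightarrow> (\<exists>y\<in>fock. x \<approx> y)"

lemma in_fock_cong: "x \<approx> y \<Longrightarrow> in_fock y \<Longrightarrow> in_fock x"
  unfolding in_fock_def by (blast intro: cl_eq_trans)

lemma in_fock_vac: "z \<in> alg_gen (range (zel q k)) \<Longrightarrow> in_fock (z * vac)"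
  unfolding in_fock_def by (blast intro: fock.vac)

lemma in_fock_zero: "in_fock 0"
  using in_fock_vac[OF alg_gen.const[of 0]] by (simp add: const_zero)

lemma in_fock_add: "in_fock x \<Longrightarrow> in_fock y \<Longrightarrow> in_fock (x + y)"
  unfolding in_fock_def by (blast intro: cl_eq_add fock.add)

lemma in_fock_psis: "in_fock x \<Longrightarrow> in_fock (psis a * x)"
  unfolding in_fock_def by (blast intro: cl_eq_lmult fock.psis)

lemma in_fock_lmultI:
  assumes "\<And>x. x \<in> fock \<Longrightarrow> in_fock (u * x)" "in_fock x"
  shows "in_fock (u * x)"
proof -
  obtain y where "y \<in> fock" "x \<approx> y" using assms(2) by (auto simp: in_fock_def)
  then show ?thesis using in_fock_cong[OF cl_eq_lmult assms(1)] by blast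
qed

lemma in_fock_const:
  fixes x :: "('n::finite, 'k) freealg"
  assumes "in_fock x"
  shows "in_fock (const c * x)"
proof (rule in_fock_lmultI[OF _ assms])
  fix x :: "('n, 'k) freealg"
  assume "x \<in> fock"
  then show "in_fock (const c * x)"
  proof induct
    case (vac z)
    then have "const c * z \<in> alg_gen (range (zel q k))"
      by (intro alg_gen.mult alg_gen.const)
    then show ?case
      using in_fock_vac by (simp flip: mult.assoc)
  next
    case (psis x a)
    then show ?case
      using in_fock_psis[of "const c * x" a] by (simp flip: smul_def)
  qed (simp add: distrib_left in_fock_add)
qed

lemma in_fock_smul: "in_fock x \<Longrightarrow> in_fock (smul c x)"
  by (simp add: smul_def in_fock_const)

text \<open>\<open>om b\<close> passes each \<open>psis a\<close> up to a scalar, and at the vacuum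
  it becomes the central \<open>zel q k b\<close>, which joins the coefficient.\<close>

lemma in_fock_om:
  fixes x :: "('n::finite, 'k) freealg"
  assumes "in_fock x"
  shows "in_fock (om b * x)"
proof (rule in_fock_lmultI[OF _ assms])
  fix x :: "('n, 'k) freealg"
  assume "x \<in> fock"
  then show "in_fock (om b * x)"
  proof induct
    case (vac z)
    have "om b * (z * vac) \<approx> z * om b * vac"
      using alg_gen_zel_central[OF vac] by (intro cl_eq_mult_assoc_left) (simp add: commutes_def)
    also have "\<dots> \<approx> z * (zel q k b * vac)"
      unfolding mult.assoc by (intro cl_eq_lmult cl_eq_sym[OF zel_vac])
    also have "\<dots> = (z * zel q k b) * vac" by (simp add: mult.assoc)
    finally show ?case
      by (rule in_fock_cong) (intro in_fock_vac alg_gen.mult vac alg_gen.gen rangeI)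
  next
    case (psis x a)
    have "om b * (psis a * x) \<approx> smul (inverse q ^ kdelta b a) (psis a * om b) * x"
      by (rule cl_eq_mult_assoc_left[OF om_psis])
    also have "\<dots> = smul (inverse q ^ kdelta b a) (psis a * (om b * x))"
      by (simp add: mult.assoc)
    finally show ?case
      by (rule in_fock_cong) (intro in_fock_smul in_fock_psis psis)
  qed (simp add: distrib_left in_fock_add)
qed

lemma in_fock_om_power: "in_fock x \<Longrightarrow> in_fock (om b ^ j * x)"
  by (induct j) (simp_all add: in_fock_om mult.assoc)

text \<open>At the vacuum \<open>om b\<close> acts as \<open>zel q k b\<close>, whose inverse is its
  power \<open>2 * k - 1\<close> by periodicity; \<open>0 < k\<close> makes this exponent a true
  predecessor of \<open>2 * k\<close>.\<close>

lemma omi_vac: "omi b * vac \<approx> zel q k b ^ (2 * k - 1) * vac"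
proof -
  let ?z = "zel q k b"
  have "omi b * vac \<approx> omi b * (?z ^ (2 * k) * vac)"
    using cl_eq_rmult[OF cl_eq_sym[OF zel_period], of vac] by (intro cl_eq_lmult) simp
  also have "\<dots> = omi b * (?z ^ (2 * k - 1) * (?z * vac))"
    using k_pos by (simp add: mult.assoc[symmetric] flip: power_Suc2)
  also have "\<dots> \<approx> ?z ^ (2 * k - 1) * omi b * (?z * vac)"
    using commutes_power[OF commutes_sym[OF centralD[OF zel_central]], of "omi b"]
    by (intro cl_eq_mult_assoc_left) (simp add: commutes_def)
  also have "\<dots> \<approx> ?z ^ (2 * k - 1) * omi b * (om b * vac)"
    by (intro cl_eq_lmult zel_vac)
  also have "\<dots> = ?z ^ (2 * k - 1) * (omi b * om b) * vac" by (simp add: mult.assoc)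
  also have "\<dots> \<approx> ?z ^ (2 * k - 1) * 1 * vac"
    by (intro cl_eq_lmult cl_eq_rmult omi_om)
  finally show ?thesis by simp
qed

lemma omi_psis: "omi b * psis a \<approx> smul (q ^ kdelta b a) (psis a * omi b)"
proof -
  let ?c = "q ^ kdelta b a"
  have "omi b * psis a * 1 \<approx> omi b * psis a * (om b * omi b)"
    by (intro cl_eq_lmult cl_eq_sym[OF om_omi])
  also have "\<dots> = smul ?c (omi b * smul (inverse q ^ kdelta b a) (psis a * om b) * omi b)"
    using q_neq_zero by (simp add: mult.assoc power_inverse)
  also have "\<dots> \<approx> smul ?c (omi b * (om b * psis a) * omi b)"
    by (intro cl_eq_smul cl_eq_lmult cl_eq_rmult cl_eq_sym[OF om_psis])
  also have "\<dots> = smul ?c ((omi b * om b) * (psis a * omi b))" by (simp add: mult.assoc)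
  also have "\<dots> \<approx> smul ?c (1 * (psis a * omi b))"
    by (intro cl_eq_smul cl_eq_rmult omi_om)
  finally show ?thesis by simp
qed

lemma in_fock_omi:
  fixes x :: "('n::finite, 'k) freealg"
  assumes "in_fock x"
  shows "in_fock (omi b * x)"
proof (rule in_fock_lmultI[OF _ assms])
  fix x :: "('n, 'k) freealg"
  assume "x \<in> fock"
  then show "in_fock (omi b * x)"
  proof induct
    case (vac z)
    have "omi b * (z * vac) \<approx> z * omi b * vac"
      using alg_gen_zel_central[OF vac] by (intro cl_eq_mult_assoc_left) (simp add: commutes_def)
    also have "\<dots> \<approx> z * (zel q k b ^ (2 * k - 1) * vac)"
      unfolding mult.assoc by (intro cl_eq_lmult omi_vac)
    also have "\<dots> = (z * zel q k b ^ (2 * k - 1)) * vac" by (simp add: mult.assoc)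
    finally show ?case
      by (rule in_fock_cong) (intro in_fock_vac alg_gen.mult vac alg_gen_power alg_gen.gen rangeI)
  next
    case (psis x a)
    have "omi b * (psis a * x) \<approx> smul (q ^ kdelta b a) (psis a * omi b) * x"
      by (rule cl_eq_mult_assoc_left[OF omi_psis])
    also have "\<dots> = smul (q ^ kdelta b a) (psis a * (omi b * x))"
      by (simp add: mult.assoc)
    finally show ?case
      by (rule in_fock_cong) (intro in_fock_smul in_fock_psis psis)
  qed (simp add: distrib_left in_fock_add)
qed

text \<open>\<open>psi b\<close> annihilates the vacuum and moves inward past each
  \<open>psis a\<close> by anticommutation; for \<open>a = b\<close> this leaves the extra term
  \<open>om a ^ k * x\<close>.\<close>

lemma in_fock_psi:
  fixes x :: "('n::finite, 'k) freealg"
  assumes "in_fock x"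
  shows "in_fock (psi b * x)"
proof (rule in_fock_lmultI[OF _ assms])
  fix x :: "('n, 'k) freealg"
  assume "x \<in> fock"
  then show "in_fock (psi b * x)"
  proof induct
    case (vac z)
    have "psi b * (z * vac) \<approx> z * psi b * vac"
      using alg_gen_zel_central[OF vac] by (intro cl_eq_mult_assoc_left) (simp add: commutes_def)
    also have "\<dots> \<approx> z * 0"
      unfolding mult.assoc by (intro cl_eq_lmult psi_vac)
    finally show ?case
      by (rule in_fock_cong) (simp add: in_fock_zero)
  next
    case (psis x a)
    show ?case
    proof (cases "a = b")
      case True
      let ?c = "inverse q ^ k"
      \<comment> \<open>The second term of the relation is added and subtracted; the remainder
        contains \<open>psi a * x\<close>, to which the induction hypothesis applies.\<close>
      have "psi a * (psis a * x)
        = (psi a * psis a + smul ?c (psis a * psi a)) * x + smul (- ?c) (psis a * (psi a * x))"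
        using smul_diff_left[of 0 ?c "psis a * (psi a * x)"] by (simp add: distrib_right mult.assoc)
      also have "\<dots> \<approx> om a ^ k * x + smul (- ?c) (psis a * (psi a * x))"
        by (intro cl_eq_add cl_eq_refl cl_eq_rmult psi_psis_om)
      finally have "in_fock (psi a * (psis a * x))"
      proof (rule in_fock_cong)
        have "in_fock x" using psis(1) by (auto simp: in_fock_def)
        then show "in_fock (om a ^ k * x + smul (- ?c) (psis a * (psi a * x)))"
          using psis(2) True
          by (intro in_fock_add in_fock_om_power in_fock_smul in_fock_psis) auto
      qed
      then show ?thesis using True by simp
    next
      case False
      have "psi b * (psis a * x) = (psi b * psis a + psis a * psi b) * x + smul (-1) (psis a * (psi b * x))"
        using smul_diff_left[of 0 1 "psis a * (psi b * x)"] by (simp add: distrib_right mult.assoc)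
      also have "\<dots> \<approx> 0 * x + smul (-1) (psis a * (psi b * x))"
        using False by (intro cl_eq_add cl_eq_refl cl_eq_rmult psi_psis) auto
      finally show ?thesis
        by (rule in_fock_cong) (simp add: in_fock_smul in_fock_psis psis)
    qed
  qed (simp add: distrib_left in_fock_add)
qed

lemma in_fock_lmult: "in_fock x \<Longrightarrow> in_fock (y * x)"
proof (induct y arbitrary: x rule: free_algebra_induct)
  case (mult u v)
  then show ?case by (simp add: mult.assoc)
qed (simp_all add: in_fock_const in_fock_psi in_fock_psis in_fock_om in_fock_omi in_fock_add
    distrib_right)

text \<open>Since \<open>vac * psis a\<close> vanishes, every term with some \<open>psis a\<close>
  in front is lost and only the vacuum coefficients remain.\<close>

lemma vac_fock:
  assumes "x \<in> fock"
  shows "\<exists>z\<in>alg_gen (range (zel q k)). vac * x \<approx> z * vac"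
  using assms
proof induct
  case (vac z)
  have "vac * (z * vac) \<approx> z * vac * vac"
    using alg_gen_zel_central[OF vac] by (intro cl_eq_mult_assoc_left) (simp add: commutes_def)
  also have "\<dots> \<approx> z * vac" unfolding mult.assoc by (intro cl_eq_lmult vac_idem)
  finally show ?case using vac by blast
next
  case (add x y)
  then obtain u v where "u \<in> alg_gen (range (zel q k))" "vac * x \<approx> u * vac"
    "v \<in> alg_gen (range (zel q k))" "vac * y \<approx> v * vac" by blast
  then show ?case
    by (intro bexI[of _ "u + v"] alg_gen.add) (simp_all add: distrib_left distrib_right cl_eq_add)
next
  case (psis x a)
  have "vac * (psis a * x) \<approx> 0 * x"
    by (rule cl_eq_mult_assoc_left[OF vac_psis])
  then show ?case
    by (intro bexI[of _ "const 0"] alg_gen.const) (simp add: const_zero)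
qed

lemma center_generated:
  fixes x :: "('n::finite, 'k) freealg"
  assumes x: "x \<in> cl_center q k"
  shows "\<exists>z\<in>alg_gen (range (zel q k)). x \<approx> z"
proof -
  have "in_fock (1 * vac)"
    using in_fock_vac[OF alg_gen.const[of 1]] by (simp add: const_one)
  then have "in_fock (x * vac)"
    using in_fock_lmult by simp
  then obtain y where y: "y \<in> fock" "x * vac \<approx> y"
    by (auto simp: in_fock_def)
  obtain z where z: "z \<in> alg_gen (range (zel q k))" "vac * y \<approx> z * vac"
    using vac_fock[OF y(1)] by blast
  \<comment> \<open>Idempotence and centrality turn \<open>x * vac\<close> into
    \<open>vac * x * vac\<close>, so only its vacuum component counts.\<close>
  have "x * vac \<approx> x * (vac * vac)"
    by (intro cl_eq_lmult cl_eq_sym[OF vac_idem])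
  also have "\<dots> \<approx> vac * x * vac"
    using centralD[OF x] by (intro cl_eq_mult_assoc_left) (simp add: commutes_def)
  also have "\<dots> \<approx> vac * y"
    unfolding mult.assoc by (intro cl_eq_lmult y)
  also have "\<dots> \<approx> z * vac" by (rule z)
  finally have "(x - z) * vac \<approx> 0"
    by (simp add: left_diff_distrib cl_eq_diff_zero)
  moreover have "x - z \<in> cl_center q k"
    by (intro centralI commutes_sym[OF commutes_diff] commutes_sym[OF centralD[OF x]]
        alg_gen_zel_central z)
  ultimately have "x - z \<approx> 0" by (rule annihilator_vac[rotated])
  then show ?thesis using z by (auto simp: cl_eq_diff_zero)
qed

end

section \<open>The Fock representation\<close>

text \<open>An arbitrary linear order of the modes, which fixes the Jordan-Wigner signs.\<close>

definition rank :: "'n::finite \<Rightarrow> nat" where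
  "rank = (SOME f. inj f)"

lemma inj_rank: "inj (rank :: 'n::finite \<Rightarrow> nat)"
proof -
  have "\<exists>f :: 'n \<Rightarrow> nat. inj f"
    using finite_imp_inj_to_nat_seg[OF finite_UNIV] by blast
  then show ?thesis unfolding rank_def by (rule someI_ex)
qed

definition pair_sign :: "'n::finite \<Rightarrow> 'n \<Rightarrow> 'k::field" where
  "pair_sign a b = (if rank b < rank a then - 1 else 1)"

text \<open>Injectivity of \<open>rank\<close> makes exactly one of the two signs negative; this
  antisymmetry yields the anticommutation of distinct modes in the representation.\<close>

lemma pair_sign_flip: "a \<noteq> b \<Longrightarrow> pair_sign b a = - pair_sign a b"
  using inj_rank unfolding pair_sign_def inj_def
  by (metis (full_types) not_less_iff_gr_or_eq add.inverse_inverse)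

lemma pair_sign_square [simp]: "pair_sign a b * pair_sign a b = 1"
  by (simp add: pair_sign_def)

lemma pair_sign_square_left [simp]: "pair_sign a b * (pair_sign a b * x) = x"
  by (simp add: pair_sign_def)

text \<open>The Jordan--Wigner sign of mode \<open>a\<close> against the occupied modes \<open>S\<close>.\<close>

definition fsign :: "'n::finite \<Rightarrow> 'n set \<Rightarrow> 'k::field" where
  "fsign a S = (\<Prod>b\<in>S - {a}. pair_sign a b)"

lemma fsign_square [simp]: "fsign a S * fsign a S = 1"
  by (simp add: fsign_def flip: prod.distrib)

lemma fsign_square_left [simp]: "fsign a S * (fsign a S * x) = x"
  by (simp flip: mult.assoc)

lemma fsign_insert_same [simp]: "fsign a (insert a S) = fsign a S"
  by (simp add: fsign_def)

lemma fsign_remove_same [simp]: "fsign a (S - {a}) = fsign a S"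
  by (simp add: fsign_def)

lemma fsign_insert: "b \<notin> S \<Longrightarrow> b \<noteq> a \<Longrightarrow> fsign a (insert b S) = pair_sign a b * fsign a S"
  by (simp add: fsign_def insert_Diff_if)

lemma fsign_remove:
  assumes "b \<in> S" "b \<noteq> a"
  shows "fsign a (S - {b}) = (pair_sign a b * fsign a S :: 'k::field)"
proof -
  have "fsign a (insert b (S - {b})) = (pair_sign a b * fsign a (S - {b}) :: 'k)"
    using assms by (intro fsign_insert) auto
  then show ?thesis using assms by (simp add: insert_absorb)
qed

context quantum_clifford
begin

text \<open>Coordinates outside \<open>{0..<2 * k}\<close> are left fixed, so that the rotation has period
  \<open>2 * k\<close> on the whole type.\<close>

definition shift :: "'n \<Rightarrow> nat \<Rightarrow> ('n \<Rightarrow> nat) \<Rightarrow> 'n \<Rightarrow> nat" where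
  "shift a j m = m(a := if m a < 2 * k then (m a + j) mod (2 * k) else m a)"

lemma shift_shift_same [simp]: "shift a i (shift a j m) = shift a (i + j) m"
  using k_pos by (auto simp: shift_def fun_eq_iff mod_simps ac_simps)

lemma shift_commute: "a \<noteq> b \<Longrightarrow> shift a i (shift b j m) = shift b j (shift a i m)"
  by (auto simp: shift_def)

lemma shift_zero [simp]: "shift a 0 m = m"
  by (auto simp: shift_def)

lemma shift_cong: "i mod (2 * k) = j mod (2 * k) \<Longrightarrow> shift a i m = shift a j m"
  by (simp add: shift_def) (metis mod_add_right_eq)

lemma shift_period [simp]: "shift a (2 * k) m = m"
  using shift_cong[of "2 * k" 0] by simp

text \<open>A vector gives a coefficient for each set \<open>S\<close> of occupied modes and each
  exponent vector \<open>m\<close>. \<open>Psi a\<close> empties and \<open>PsiS a\<close> fills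
  mode \<open>a\<close>; their anticommutator has to act as \<open>zel q k a ^ k\<close>, and the
  shift by \<open>k\<close> that this requires is placed in \<open>Psi a\<close>.
  \<open>Om a\<close> is \<open>zel q k a\<close> on an empty mode and \<open>inverse q\<close>
  times it on a filled one; \<open>2 * k - 1\<close> stands for -1 modulo
  \<open>2 * k\<close>.\<close>

fun act :: "'n::finite gen \<Rightarrow> ('n set \<Rightarrow> ('n \<Rightarrow> nat) \<Rightarrow> 'k) \<Rightarrow> 'n set \<Rightarrow> ('n \<Rightarrow> nat) \<Rightarrow> 'k" where
  "act (Om a) v S m = (if a \<in> S then inverse q else 1) * v S (shift a 1 m)"
| "act (OmI a) v S m = (if a \<in> S then q else 1) * v S (shift a (2 * k - 1) m)"
| "act (Psi a) v S m = (if a \<in> S then 0 else fsign a S * v (insert a S) (shift a k m))"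
| "act (PsiS a) v S m = (if a \<in> S then fsign a S * v (S - {a}) m else 0)"

fun word_act :: "'n::finite gen word \<Rightarrow> ('n set \<Rightarrow> ('n \<Rightarrow> nat) \<Rightarrow> 'k) \<Rightarrow> 'n set \<Rightarrow> ('n \<Rightarrow> nat) \<Rightarrow> 'k" where
  "word_act (Word xs) v = List.foldr act xs v"

definition rep :: "('n::finite, 'k) freealg \<Rightarrow> ('n set \<Rightarrow> ('n \<Rightarrow> nat) \<Rightarrow> 'k) \<Rightarrow> 'n set \<Rightarrow> ('n \<Rightarrow> nat) \<Rightarrow> 'k" where
  "rep x v S m = (\<Sum>w\<in>Poly_Mapping.keys x. Poly_Mapping.lookup x w * word_act w v S m)"

lemma word_act_plus: "word_act (u + w) v = word_act u (word_act w v)"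
  by (cases u; cases w) simp

lemma act_add: "act g (\<lambda>S m. u S m + v S m) = (\<lambda>S m. act g u S m + act g v S m)"
  by (cases g) (auto simp: fun_eq_iff algebra_simps)

lemma act_scale: "act g (\<lambda>S m. c * v S m) = (\<lambda>S m. c * act g v S m)"
  by (cases g) (auto simp: fun_eq_iff)

lemma word_act_add: "word_act w (\<lambda>S m. u S m + v S m) = (\<lambda>S m. word_act w u S m + word_act w v S m)"
proof (cases w)
  case (Word xs)
  have "List.foldr act xs (\<lambda>S m. u S m + v S m) = (\<lambda>S m. List.foldr act xs u S m + List.foldr act xs v S m)"
    by (induct xs) (simp_all add: act_add)
  then show ?thesis by (simp add: Word)
qed

lemma word_act_scale: "word_act w (\<lambda>S m. c * v S m) = (\<lambda>S m. c * word_act w v S m)"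
proof (cases w)
  case (Word xs)
  have "List.foldr act xs (\<lambda>S m. c * v S m) = (\<lambda>S m. c * List.foldr act xs v S m)"
    by (induct xs) (simp_all add: act_scale)
  then show ?thesis by (simp add: Word)
qed

section \<open>Linearity and multiplicativity of the representation\<close>

lemma rep_zero [simp]: "rep 0 v S m = 0"
  by (simp add: rep_def)

lemma rep_add [simp]: "rep (x + y) v S m = rep x v S m + rep y v S m"
  unfolding rep_def by (rule setsum_keys_plus_distrib) (simp_all add: distrib_right)

lemma rep_single: "rep (Poly_Mapping.single w c) v S m = c * word_act w v S m"
  by (simp add: rep_def)

lemma rep_scale: "rep x (\<lambda>S m. c * v S m) S m = c * rep x v S m"
  by (simp add: rep_def word_act_scale sum_distrib_left mult.left_commute)

lemma rep_zero_right [simp]: "rep x (\<lambda>S m. 0) S m = 0"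
  using rep_scale[of x 0] by simp

text \<open>Linearity in both factors reduces this to monomials, where it is
  \<open>word_act_plus\<close>.\<close>

lemma rep_mult [simp]: "rep (x * y) v S m = rep x (rep y v) S m"
proof (induct x rule: poly_mapping_single_induct)
  case (add f w b)
  have "rep (Poly_Mapping.single w b * y) v S m = rep (Poly_Mapping.single w b) (rep y v) S m"
  proof (induct y rule: poly_mapping_single_induct)
    case zero
    have "rep 0 v = (\<lambda>S m. 0)" by (simp add: fun_eq_iff)
    then show ?case by simp
  next
    case (add f w' b')
    have "rep (f + Poly_Mapping.single w' b') v
      = (\<lambda>S m. rep f v S m + b' * word_act w' v S m)"
      by (simp add: fun_eq_iff rep_single)
    then show ?case
      using add by (simp add: distrib_left mult_single rep_single word_act_plus word_act_add
          word_act_scale)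
  qed
  then show ?case using add by (simp add: distrib_right)
qed simp

lemma rep_const [simp]: "rep (const c) v S m = c * v S m"
  by (simp add: const_def rep_single zero_word_def)

lemma rep_one [simp]: "rep 1 v S m = v S m"
  using rep_const[of 1] by (simp add: const_one)

lemma rep_const_mult: "rep (const c * x) v S m = c * rep x v S m"
  by simp

lemma rep_smul [simp]: "rep (smul c x) v S m = c * rep x v S m"
  by (simp add: smul_def)

lemma rep_uminus [simp]: "rep (- x) v S m = - rep x v S m"
  using rep_smul[of "-1" x v S m] by (simp add: smul_def const_uminus const_one)

lemma rep_diff [simp]: "rep (x - y) v S m = rep x v S m - rep y v S m"
  using rep_add[of x "- y" v S m] by simp

lemma rep_sum [simp]: "rep (sum f A) v S m = (\<Sum>i\<in>A. rep (f i) v S m)"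
  by (induct A rule: infinite_finite_induct) simp_all

lemma rep_gen: "rep (gen g) v = act g v"
  by (simp add: gen_def rep_single fun_eq_iff)

lemmas rep_psi [simp] = rep_gen[of "Psi a" for a, folded psi_def]
lemmas rep_psis [simp] = rep_gen[of "PsiS a" for a, folded psis_def]
lemmas rep_om [simp] = rep_gen[of "Om a" for a, folded om_def]
lemmas rep_omi [simp] = rep_gen[of "OmI a" for a, folded omi_def]

section \<open>The defining relations in the representation\<close>

lemma rep_om_power: "rep (om a ^ j) v S m = (if a \<in> S then inverse q ^ j else 1) * v S (shift a j m)"
  by (induct j arbitrary: m) (simp_all add: add.commute)

lemma rep_omi_power:
  "rep (omi a ^ j) v S m = (if a \<in> S then q ^ j else 1) * v S (shift a (j * (2 * k - 1)) m)"
  by (induct j arbitrary: m) (simp_all add: add.commute)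

text \<open>Translation by \<open>-k\<close> and by \<open>k\<close> agree modulo
  \<open>2 * k\<close>, so the relations with \<open>om a ^ k\<close> and with
  \<open>omi a ^ k\<close> ask for the same translation.\<close>

lemma shift_omi_power: "shift a (k * (2 * k - 1)) m = shift a k m"
proof (rule shift_cong)
  have "k * (2 * k - 1) = k + 2 * k * (k - 1)"
    using k_pos by (cases k) (simp_all add: algebra_simps)
  then show "k * (2 * k - 1) mod (2 * k) = k mod (2 * k)" by (simp del: mult_Suc)
qed

lemma rep_omi_power_k: "rep (omi a ^ k) v S m = (if a \<in> S then q ^ k else 1) * v S (shift a k m)"
  by (simp only: rep_omi_power shift_omi_power)

lemma rep_om_omi: "rep (om a * omi a) v S m = v S m" "rep (omi a * om a) v S m = v S m"
  using k_pos q_neq_zero by simp_all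

lemma rep_om_om: "rep (om a * om b) v S m - rep (om b * om a) v S m = 0"
  by (cases "a = b") (simp_all add: shift_commute)

lemma rep_om_psi: "rep (om a * psi b) v S m = q ^ kdelta a b * rep (psi b * om a) v S m"
  using q_neq_zero by (cases "a = b") (simp_all add: kdelta_def shift_commute add.commute)

lemma rep_om_psis: "rep (om a * psis b) v S m = inverse q ^ kdelta a b * rep (psis b * om a) v S m"
  using q_neq_zero by (cases "a = b") (simp_all add: kdelta_def)

lemma rep_psi_psi: "rep (psi a * psi b) v S m + rep (psi b * psi a) v S m = 0"
proof (cases "a = b")
  case False
  then show ?thesis
    by (auto simp: fsign_insert pair_sign_flip[of a b] shift_commute insert_commute)
qed simp

lemma rep_psis_psis: "rep (psis a * psis b) v S m + rep (psis b * psis a) v S m = 0"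
proof (cases "a = b")
  case False
  then show ?thesis
    by (auto simp: fsign_remove pair_sign_flip[of a b] Diff_insert2[symmetric] insert_commute)
qed simp

lemma rep_psi_psis: "a \<noteq> b \<Longrightarrow> rep (psi a * psis b) v S m + rep (psis b * psi a) v S m = 0"
  by (auto simp: fsign_remove fsign_insert pair_sign_flip[of a b] insert_Diff_if)

text \<open>For each \<open>S\<close> only one product survives: \<open>psi a * psis a\<close> if
  \<open>a\<close> is empty, the other if it is filled. The coefficient \<open>c\<close> stays open
  to serve both relations, with \<open>q ^ k\<close> and with \<open>inverse q ^ k\<close>.\<close>

lemma rep_anticommutator:
  "rep (psi a * psis a) v S m + c * rep (psis a * psi a) v S m
    = (if a \<in> S then c else 1) * v S (shift a k m)"
  by (simp add: insert_absorb)

lemma rep_ideal: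
  assumes "x \<in> cl_ideal q k"
  shows "rep x v S m = 0"
  using assms
proof (induct arbitrary: v S m)
  case (rel r)
  then show ?case
    unfolding cl_rels_def
    \<comment> \<open>\<open>rep_mult\<close> stays out of the simp set so that the lemmas on whole
      products match; \<open>mult.assoc\<close> exposes the scalars in front.\<close>
    by (elim UnE CollectE exE conjE; hypsubst)
      (simp_all only: rep_add rep_diff rep_one rep_om_omi rep_om_om rep_om_psi rep_om_psis
        rep_psi_psi rep_psi_psis rep_psis_psis mult.assoc rep_const_mult rep_anticommutator
        rep_om_power rep_omi_power_k diff_self not_False_eq_True)
next
  case (lmult x u)
  have "rep x v = (\<lambda>S m. 0)" using lmult by (simp add: fun_eq_iff)
  then show ?case by simp
qed simp_all

lemma rep_cong: "x \<approx> y \<Longrightarrow> rep x v S m = rep y v S m"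
  using rep_ideal[of "x - y" v S m] by (simp add: cl_eq_def)

text \<open>The second summand of \<open>zel\<close> translates by \<open>k\<close> through
  \<open>psi a\<close> and by \<open>k + 1\<close> through the power of \<open>om a\<close>, hence
  by 1 modulo \<open>2 * k\<close>, just like the first; the coefficients add up to
  \<open>q - (q - 1)\<close>.\<close>

lemma rep_zel_vacuum: "rep (zel q k a) v {} m = v {} (shift a 1 m)"
proof -
  have "shift a (k + (k + 1)) m = shift a 1 m"
    using mod_mult_self2[of 1 "2 * k" 1] by (intro shift_cong) (simp add: algebra_simps)
  then show ?thesis
    by (simp add: zel_def mult.assoc rep_om_power algebra_simps del: power_Suc)
qed

lemma rep_zel_power_vacuum: "rep (zel q k a ^ j) v {} m = v {} (shift a j m)"
  by (induct j arbitrary: m) (simp_all add: rep_zel_vacuum add.commute)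

lemma zel_order:
  fixes a :: "'n::finite"
  assumes "0 < j" "j < 2 * k"
  shows "\<not> zel q k a ^ j \<approx> 1"
proof
  assume "zel q k a ^ j \<approx> 1"
  \<comment> \<open>The test vector is the indicator of \<open>m a = 0\<close>: at the zero exponent
    vector the identity gives 1, while the \<open>j\<close>-th power reads it at exponent
    \<open>j\<close>, where it is 0.\<close>
  from rep_cong[OF this, of "\<lambda>S m. of_bool (m a = 0)" "{}" "\<lambda>_. 0"]
  show False
    using assms k_pos by (simp add: rep_zel_power_vacuum shift_def)
qed

end

section \<open>The group algebra\<close>

lemma cgrp_eq_PiE: "(cgrp k :: ('n::finite \<Rightarrow> nat) set) = PiE UNIV (\<lambda>_. {..<2 * k})"
  by (auto simp: cgrp_def PiE_UNIV_domain)

lemma finite_cgrp [simp]: "finite (cgrp k :: ('n::finite \<Rightarrow> nat) set)"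
  unfolding cgrp_eq_PiE by (rule finite_PiE) simp_all

lemma card_cgrp: "card (cgrp k :: ('n::finite \<Rightarrow> nat) set) = (2 * k) ^ card (UNIV :: 'n set)"
  unfolding cgrp_eq_PiE by (simp add: card_PiE)

context quantum_clifford
begin

definition zmon :: "('n::finite \<Rightarrow> nat) \<Rightarrow> ('n, 'k) freealg" where
  "zmon g = prod_list (map (\<lambda>a. zel q k a ^ g a) modes)"

lemma zmon_alg_gen: "zmon g \<in> alg_gen (range (zel q k))"
  unfolding zmon_def by (rule alg_gen_prod_list) (auto intro: alg_gen_power alg_gen.gen)

lemma commutes_zmon: "commutes y (zmon g)"
  by (rule alg_gen_zel_central[OF zmon_alg_gen])

lemma zmon_zero: "zmon (\<lambda>_. 0) = (1 :: ('n::finite, 'k) freealg)"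
proof -
  have "prod_list (map (\<lambda>a. zel q k a ^ 0) xs) = 1" for xs :: "'n list"
    by (induct xs) simp_all
  then show ?thesis by (simp only: zmon_def)
qed

lemma zmon_unit: "zmon (\<lambda>b. if b = a then 1 else 0) = zel q k a"
proof -
  have "prod_list (map (\<lambda>b. zel q k b ^ (if b = a then 1 else 0)) xs)
      = (if a \<in> set xs then zel q k a else 1)" if "distinct xs" for xs
    using that by (induct xs) auto
  then show ?thesis by (simp add: zmon_def modes)
qed

lemma zmon_cong:
  assumes "\<And>a. zel q k a ^ g a \<approx> zel q k a ^ h a"
  shows "zmon g \<approx> zmon h"
proof -
  have "prod_list (map (\<lambda>a. zel q k a ^ g a) xs) \<approx> prod_list (map (\<lambda>a. zel q k a ^ h a) xs)" for xs
    by (induct xs) (simp_all add: cl_eq_mult assms)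
  then show ?thesis by (simp add: zmon_def)
qed

lemma zel_power_mod: "zel q k a ^ j \<approx> zel q k a ^ (j mod (2 * k))"
proof -
  have "zel q k a ^ j = (zel q k a ^ (2 * k)) ^ (j div (2 * k)) * zel q k a ^ (j mod (2 * k))"
    by (simp flip: power_mult power_add)
  also have "\<dots> \<approx> 1 ^ (j div (2 * k)) * zel q k a ^ (j mod (2 * k))"
    by (intro cl_eq_rmult cl_eq_power zel_period)
  finally show ?thesis by simp
qed

text \<open>Centrality collects the powers of each \<open>zel q k a\<close>, and periodicity reduces
  the exponents to the group law.\<close>

lemma zmon_mult: "zmon g * zmon h \<approx> zmon (cgadd k g h)"
proof -
  have "prod_list (map (\<lambda>a. zel q k a ^ g a) xs) * prod_list (map (\<lambda>a. zel q k a ^ h a) xs)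
      \<approx> prod_list (map (\<lambda>a. zel q k a ^ (g a + h a)) xs)" for xs
  proof (induct xs)
    case (Cons x xs)
    let ?G = "prod_list (map (\<lambda>a. zel q k a ^ g a) xs)"
      and ?H = "prod_list (map (\<lambda>a. zel q k a ^ h a) xs)"
    have "zel q k x ^ g x * ?G * (zel q k x ^ h x * ?H)
        = zel q k x ^ g x * ((?G * zel q k x ^ h x) * ?H)" by (simp add: mult.assoc)
    also have "\<dots> \<approx> zel q k x ^ g x * ((zel q k x ^ h x * ?G) * ?H)"
      using commutes_power[OF commutes_sym[OF centralD[OF zel_central]], of ?G]
      by (intro cl_eq_lmult cl_eq_rmult) (simp add: commutes_def)
    also have "\<dots> = zel q k x ^ (g x + h x) * (?G * ?H)" by (simp add: mult.assoc power_add)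
    also have "\<dots> \<approx> zel q k x ^ (g x + h x) * prod_list (map (\<lambda>a. zel q k a ^ (g a + h a)) xs)"
      by (rule cl_eq_lmult) fact
    finally show ?case by simp
  qed simp
  then have "zmon g * zmon h \<approx> zmon (\<lambda>a. g a + h a)" by (simp add: zmon_def)
  also have "\<dots> \<approx> zmon (cgadd k g h)"
    unfolding cgadd_def by (rule zmon_cong) (rule zel_power_mod)
  finally show ?thesis .
qed

text \<open>The monomial acts as a composite of shifts carrying the zero exponent vector to
  \<open>g\<close>; a suitable \<open>v\<close> thus separates monomials.\<close>

lemma rep_zmon_vacuum:
  assumes g: "g \<in> cgrp k"
  shows "rep (zmon g) v {} (\<lambda>_. 0) = v {} g"
proof -
  have rep: "rep (prod_list (map (\<lambda>a. zel q k a ^ g a) xs)) v {} m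
      = v {} (fold (\<lambda>a. shift a (g a)) xs m)" for xs m
    by (induct xs arbitrary: m) (simp_all add: rep_zel_power_vacuum)
  \<comment> \<open>Distinctness ensures that each coordinate is shifted only once.\<close>
  have "fold (\<lambda>a. shift a (g a)) xs m
      = (\<lambda>i. if i \<in> set xs \<and> m i < 2 * k then (m i + g i) mod (2 * k) else m i)"
    if "distinct xs" for xs m
    using that by (induct xs arbitrary: m) (auto simp: shift_def fun_eq_iff)
  from this[OF modes(2), of "\<lambda>_. 0"] have "fold (\<lambda>a. shift a (g a)) modes (\<lambda>_. 0) = g"
    using g k_pos by (simp add: modes cgrp_def)
  then show ?thesis by (simp add: zmon_def rep)
qed

section \<open>The isomorphism with the group algebra, and the dimension of the center\<close>

definition center_map :: "(('n::finite \<Rightarrow> nat) \<Rightarrow> 'k) \<Rightarrow> ('n, 'k) freealg" where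
  "center_map f = (\<Sum>g\<in>cgrp k. smul (f g) (zmon g))"

lemma center_map_alg_gen: "center_map f \<in> alg_gen (range (zel q k))"
  unfolding center_map_def smul_def
  by (intro alg_gen_sum alg_gen.mult alg_gen.const zmon_alg_gen)

lemma center_map_central: "center_map f \<in> cl_center q k"
  by (intro centralI commutes_sym[OF alg_gen_zel_central] center_map_alg_gen)

lemma center_map_add: "center_map (\<lambda>g. f g + h g) = center_map f + center_map h"
  by (simp add: center_map_def smul_add_left sum.distrib)

lemma center_map_scale: "center_map (\<lambda>g. c * f g) = const c * center_map f"
  by (simp add: center_map_def smul_sum_right flip: smul_def)

lemma center_map_delta:
  "h \<in> cgrp k \<Longrightarrow> center_map (\<lambda>g. if g = h then c else 0) = smul c (zmon h)"
proof -
  assume h: "h \<in> cgrp k"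
  have "center_map (\<lambda>g. if g = h then c else 0) = (\<Sum>g\<in>cgrp k. if g = h then smul c (zmon h) else 0)"
    unfolding center_map_def by (intro sum.cong) auto
  then show ?thesis using h by simp
qed

lemma zero_in_cgrp: "(\<lambda>_. 0) \<in> cgrp k"
  using k_pos by (simp add: cgrp_def)

lemma cgadd_in_cgrp: "cgadd k g h \<in> cgrp k"
  using k_pos by (simp add: cgrp_def cgadd_def)

lemma center_map_one: "center_map ga_one = 1"
  unfolding ga_one_def by (simp add: center_map_delta[OF zero_in_cgrp] zmon_zero)

lemma center_map_mult: "center_map (ga_mult k f h) \<approx> center_map f * center_map h"
proof -
  have "center_map (ga_mult k f h)
      = (\<Sum>x\<in>cgrp k. \<Sum>g\<in>cgrp k. \<Sum>g'\<in>cgrp k.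
          if cgadd k g g' = x then smul (f g * h g') (zmon x) else 0)"
    unfolding center_map_def ga_mult_def
    by (intro sum.cong refl) (simp add: smul_sum_left if_distrib[of "\<lambda>c. smul c _"] cong: if_cong)
  \<comment> \<open>The sum over \<open>x\<close> is moved innermost, where the condition selects
    the single term \<open>x = cgadd k g g'\<close>.\<close>
  also have "\<dots> = (\<Sum>g\<in>cgrp k. \<Sum>x\<in>cgrp k. \<Sum>g'\<in>cgrp k.
          if cgadd k g g' = x then smul (f g * h g') (zmon x) else 0)"
    by (rule sum.swap)
  also have "\<dots> = (\<Sum>g\<in>cgrp k. \<Sum>g'\<in>cgrp k. \<Sum>x\<in>cgrp k.
          if cgadd k g g' = x then smul (f g * h g') (zmon x) else 0)"
    by (intro sum.cong refl sum.swap)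
  also have "\<dots> = (\<Sum>g\<in>cgrp k. \<Sum>g'\<in>cgrp k. smul (f g * h g') (zmon (cgadd k g g')))"
    by (intro sum.cong refl) (simp add: cgadd_in_cgrp)
  also have "\<dots> \<approx> (\<Sum>g\<in>cgrp k. \<Sum>g'\<in>cgrp k. smul (f g * h g') (zmon g * zmon g'))"
    by (intro cl_eq_sum cl_eq_smul cl_eq_sym[OF zmon_mult])
  also have "\<dots> = center_map f * center_map h"
    by (simp add: center_map_def sum_product mult.commute[of "f _"])
  finally show ?thesis .
qed

lemma center_map_inj:
  fixes f :: "('n::finite \<Rightarrow> nat) \<Rightarrow> 'k"
  assumes "center_map f \<approx> 0" and g: "g \<in> cgrp k"
  shows "f g = 0"
proof -
  \<comment> \<open>The indicator of \<open>g\<close> picks out the coefficient of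
    \<open>zmon g\<close>.\<close>
  let ?v = "\<lambda>(S :: 'n set) m. if m = g then 1 else 0 :: 'k"
  have "rep (center_map f) ?v {} (\<lambda>_. 0) = (\<Sum>h\<in>cgrp k. f h * (if h = g then 1 else 0))"
    unfolding center_map_def by (simp add: rep_zmon_vacuum)
  also have "\<dots> = f g" using g by (simp add: if_distrib cong: if_cong)
  finally show ?thesis
    using rep_cong[OF assms(1), of ?v "{}" "\<lambda>_. 0"] by simp
qed

text \<open>Modulo the relations the image is a subalgebra: scalars come from functions supported at
  zero, each \<open>zel q k a\<close> from a unit exponent vector (in \<open>cgrp k\<close> because
  \<open>1 < 2 * k\<close>), and products from convolution.\<close>

lemma alg_gen_center_map:
  fixes z :: "('n::finite, 'k) freealg"
  assumes "z \<in> alg_gen (range (zel q k))"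
  shows "\<exists>f\<in>galg k. z \<approx> center_map f"
  using assms
proof induct
  case (const c)
  have "(const c :: ('n, 'k) freealg) = center_map (\<lambda>g. if g = (\<lambda>_. 0) then c else 0)"
    by (simp add: center_map_delta[OF zero_in_cgrp] zmon_zero smul_def)
  then show ?case
    by (intro bexI[of _ "\<lambda>g. if g = (\<lambda>_. 0) then c else 0"]) (auto simp: galg_def zero_in_cgrp)
next
  case (gen s)
  then obtain a where s: "s = zel q k a" by blast
  let ?d = "\<lambda>b. if b = a then 1 else 0 :: nat"
  have d: "?d \<in> cgrp k" using k_pos by (auto simp: cgrp_def)
  have "s = center_map (\<lambda>g. if g = ?d then 1 else 0)"
    by (simp add: center_map_delta[OF d] zmon_unit s)
  then show ?case
    using d by (intro bexI[of _ "\<lambda>g. if g = ?d then 1 else 0"]) (auto simp: galg_def)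
next
  case (add x y)
  then obtain f h where fh: "f \<in> galg k" "x \<approx> center_map f" "h \<in> galg k" "y \<approx> center_map h"
    by blast
  then show ?case
    by (intro bexI[of _ "\<lambda>g. f g + h g"]) (auto simp: galg_def center_map_add cl_eq_add)
next
  case (mult x y)
  then obtain f h where fh: "x \<approx> center_map f" "y \<approx> center_map h"
    by blast
  have "x * y \<approx> center_map (ga_mult k f h)"
    by (rule cl_eq_trans[OF cl_eq_mult[OF fh] cl_eq_sym[OF center_map_mult]])
  then show ?case
    by (intro bexI[of _ "ga_mult k f h"]) (auto simp: galg_def ga_mult_def)
qed

lemma center_map_surj:
  "z \<in> cl_center q k \<Longrightarrow> \<exists>f\<in>galg k. z \<approx> center_map f"
  using center_generated alg_gen_center_map cl_eq_trans by meson

lemma center_iso_center_map: "center_iso q k (center_map :: (('n::finite \<Rightarrow> nat) \<Rightarrow> 'k) \<Rightarrow> _)"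
  unfolding center_iso_def
proof (intro conjI ballI allI impI)
  show "f = (\<lambda>_. 0)" if "f \<in> galg k" "center_map f \<approx> 0" for f :: "('n \<Rightarrow> nat) \<Rightarrow> 'k"
    using that center_map_inj[OF that(2)] by (auto simp: galg_def fun_eq_iff)
qed (simp_all add: center_map_central center_map_add center_map_scale center_map_mult center_map_one
    center_map_surj)

text \<open>\<open>center_dim\<close> counts a set of representatives, so distinct exponents must
  give distinct elements; the indicator of one exponent separates them.\<close>

lemma inj_on_zmon: "inj_on zmon (cgrp k)"
proof (rule inj_onI, rule ccontr)
  fix g h :: "'b::finite \<Rightarrow> nat"
  assume gh: "g \<in> cgrp k" "h \<in> cgrp k" "zmon g = zmon h" "g \<noteq> h"
  from rep_zmon_vacuum[OF gh(1), of "\<lambda>S m. of_bool (m = g)"]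
    rep_zmon_vacuum[OF gh(2), of "\<lambda>S m. of_bool (m = g)"]
  show False using gh by simp
qed

lemma center_dim: "center_dim q k ((2 * k) ^ card (UNIV :: 'n::finite set)) TYPE('n)"
proof -
  let ?B = "zmon ` (cgrp k :: ('n \<Rightarrow> nat) set)"
  have sum: "(\<Sum>b\<in>?B. const (c b) * b) = center_map (\<lambda>g. c (zmon g))" for c
    by (simp add: sum.reindex[OF inj_on_zmon] center_map_def smul_def)
  have "?B \<subseteq> cl_center q k"
    by (auto intro!: centralI commutes_sym[OF commutes_zmon])
  moreover have "\<forall>b\<in>?B. c b = 0" if "(\<Sum>b\<in>?B. const (c b) * b) \<approx> 0" for c
    using center_map_inj[OF that[unfolded sum]] by blast
  moreover have "\<exists>c. z \<approx> (\<Sum>b\<in>?B. const (c b) * b)" if z: "z \<in> cl_center q k" for z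
  proof -
    obtain f where f: "z \<approx> center_map f" using center_map_surj[OF z] by blast
    \<comment> \<open>Coefficients in \<open>center_dim\<close> are indexed by the basis elements
      themselves, so \<open>f\<close> is transported along the inverse of
      \<open>zmon\<close>.\<close>
    have "center_map (\<lambda>g. f (the_inv_into (cgrp k) zmon (zmon g))) = center_map f"
      unfolding center_map_def
      by (intro sum.cong refl) (simp add: the_inv_into_f_f[OF inj_on_zmon])
    then have "z \<approx> (\<Sum>b\<in>?B. const (f (the_inv_into (cgrp k) zmon b)) * b)"
      using f by (simp only: sum)
    then show ?thesis by (intro exI)
  qed
  ultimately show ?thesis
    unfolding center_dim_def
    by (intro exI[of _ ?B]) (auto simp: card_image[OF inj_on_zmon] card_cgrp)
qed

end

theorem theorem3p12:
  fixes q :: "'k::field" and k :: nat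
  assumes char: "(2::'k) \<noteq> 0"
    and q: "q \<noteq> 0"
    and k: "0 < k"
  shows "(\<exists>phi :: (('n::finite \<Rightarrow> nat) \<Rightarrow> 'k) \<Rightarrow> ('n, 'k) freealg. center_iso q k phi)
    \<and> (\<forall>a::'n. zel q k a \<in> cl_center q k)
    \<and> (\<forall>z\<in>cl_center q k. \<exists>y\<in>alg_gen (range (zel q k :: 'n \<Rightarrow> ('n, 'k) freealg)). cl_eq q k z y)
    \<and> (\<forall>a::'n. cl_eq q k (zel q k a ^ (2 * k)) 1
          \<and> (\<forall>j. 0 < j \<and> j < 2 * k \<longrightarrow> \<not> cl_eq q k (zel q k a ^ j) 1))
    \<and> center_dim q k ((2 * k) ^ card (UNIV :: 'n set)) TYPE('n)
    \<and> (\<forall>a::'n. cl_eq q k (psi a * psis a + psis a * psi a) (zel q k a ^ k))"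
proof -
  interpret quantum_clifford q k
    by unfold_locales (fact char q k)+
  show ?thesis
    by (intro conjI ballI allI impI exI[of _ center_map] center_iso_center_map zel_central
        center_generated zel_period center_dim anticommutator_eq_zel_power zel_order) auto
qed

end
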